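(* Let $q,s\ge 1$ and $k\ge 4$ be integers and let $G\cong K_1\vee (C_k\cup qK_2\cup sK_1)$ have at least $21$ vertices. If $k$ is odd, then $G$ is DQS. Moreover, if $k$ is even and $F$ is a graph that is $Q$-cospectral with $G$, then $$F\cong G \quad\text{or}\quad F\cong K_1\vee (C_{4}\cup P_{k-3}\cup P_{3}\cup (q-2)K_2 \cup sK_1).$$
   Context: All graphs are finite, simple and undirected. $P_n$, $C_n$, $K_n$ denote the path, cycle and complete graph on $n$ vertices; $\cup$ is disjoint union, $rH$ is the disjoint union of $r$ copies of $H$ (with $0H$ the empty graph), and $\vee$ is the join (add all edges between the two graphs). The signless Laplacian matrix of $G$ is $Q(G)=D(G)+A(G)$, where $D(G)$ is the diagonal matrix of vertex degrees and $A(G)$ the adjacency matrix. The $Q$-spectrum is the multiset of eigenvalues of $Q(G)$. Two graphs are $Q$-cospectral if they have the same $Q$-spectrum; $G$ is DQS if every graph $Q$-cospectral with $G$ is isomorphic to $G$. When $q=1$ the second alternative is void, since $(q-2)K_2$ is then not defined. *)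

theory Defs
  imports
    "Graph_Theory.Graph_Theory"
    "Jordan_Normal_Form.Char_Poly"
    "HOL-Computational_Algebra.Fundamental_Theorem_Algebra"
begin

text \<open>
  A finite simple undirected graph is a \<open>pair_graph\<close>: a finite vertex set with a symmetric
  irreflexive arc relation, the edge \<open>uv\<close> being the pair of arcs \<open>(u,v)\<close> and \<open>(v,u)\<close>.
\<close>

abbreviation graph_iso :: "'a pair_pre_digraph \<Rightarrow> 'b pair_pre_digraph \<Rightarrow> bool"
    (infix \<open>\<simeq>\<close> 50) where
  "G \<simeq> H \<equiv> digraph_iso (with_proj G) (with_proj H)"

definition complete_graph :: "nat \<Rightarrow> nat pair_pre_digraph" where
  "complete_graph n = \<lparr> pverts = {..<n}, parcs = {(i,j). i < n \<and> j < n \<and> i \<noteq> j} \<rparr>"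

definition path_graph :: "nat \<Rightarrow> nat pair_pre_digraph" where
  "path_graph n = \<lparr> pverts = {..<n}, parcs = {(i,j). i < n \<and> j < n \<and> (j = Suc i \<or> i = Suc j)} \<rparr>"

text \<open>The following is the cycle only for \<open>n \<ge> 3\<close>.\<close>

definition cycle_graph :: "nat \<Rightarrow> nat pair_pre_digraph" where
  "cycle_graph n = \<lparr> pverts = {..<n},
     parcs = {(i,j). i < n \<and> j < n \<and> (j = Suc i mod n \<or> i = Suc j mod n)} \<rparr>"

definition disj_union ::
    "'a pair_pre_digraph \<Rightarrow> 'b pair_pre_digraph \<Rightarrow> ('a + 'b) pair_pre_digraph"
    (infixr \<open>\<squnion>\<^sub>g\<close> 65) where
  "G \<squnion>\<^sub>g H = \<lparr> pverts = pverts G <+> pverts H,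
     parcs = map_prod Inl Inl ` parcs G \<union> map_prod Inr Inr ` parcs H \<rparr>"

definition graph_join ::
    "'a pair_pre_digraph \<Rightarrow> 'b pair_pre_digraph \<Rightarrow> ('a + 'b) pair_pre_digraph"
    (infixr \<open>\<or>\<^sub>g\<close> 60) where
  "G \<or>\<^sub>g H = \<lparr> pverts = pverts G <+> pverts H,
     parcs = parcs (G \<squnion>\<^sub>g H)
       \<union> (Inl ` pverts G) \<times> (Inr ` pverts H) \<union> (Inr ` pverts H) \<times> (Inl ` pverts G) \<rparr>"

definition copies :: "nat \<Rightarrow> 'a pair_pre_digraph \<Rightarrow> (nat \<times> 'a) pair_pre_digraph"
    (infixr \<open>\<cdot>\<^sub>g\<close> 70) where
  "r \<cdot>\<^sub>g H = \<lparr> pverts = {..<r} \<times> pverts H,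
     parcs = {((i,u),(j,v)). i < r \<and> i = j \<and> (u,v) \<in> parcs H} \<rparr>"

text \<open>
  The matrices are indexed by positions in an enumeration \<open>vs\<close> of the vertices. Their entries are
  complex, so that all eigenvalues are present as roots of the characteristic polynomial.
\<close>

definition degree_matrix :: "'a pair_pre_digraph \<Rightarrow> 'a list \<Rightarrow> complex mat" where
  "degree_matrix G vs = mat (length vs) (length vs)
     (\<lambda>(i,j). if i = j then of_nat (out_degree (with_proj G) (vs ! i)) else 0)"

definition adjacency_matrix :: "'a pair_pre_digraph \<Rightarrow> 'a list \<Rightarrow> complex mat" where
  "adjacency_matrix G vs = mat (length vs) (length vs)
     (\<lambda>(i,j). if (vs ! i, vs ! j) \<in> parcs G then 1 else 0)"

definition signless_laplacian :: "'a pair_pre_digraph \<Rightarrow> 'a list \<Rightarrow> complex mat" where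
  "signless_laplacian G vs = degree_matrix G vs + adjacency_matrix G vs"

definition vertex_enum :: "'a pair_pre_digraph \<Rightarrow> 'a list" where
  "vertex_enum G = (SOME vs. distinct vs \<and> set vs = pverts G)"

text \<open>By \<open>q_spectrum_eq\<close> below the choice of enumeration is immaterial.\<close>

definition q_spectrum :: "'a pair_pre_digraph \<Rightarrow> complex multiset" where
  "q_spectrum G = proots (char_poly (signless_laplacian G (vertex_enum G)))"

definition q_cospectral :: "'a pair_pre_digraph \<Rightarrow> 'b pair_pre_digraph \<Rightarrow> bool" where
  "q_cospectral G H \<longleftrightarrow> q_spectrum G = q_spectrum H"

text \<open>
  Every finite graph has an isomorphic copy with vertices in \<open>nat\<close>, so quantifying over those
  suffices; \<open>dqsD\<close> below gives the property for graphs over an arbitrary vertex type.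
\<close>

definition dqs :: "'a pair_pre_digraph \<Rightarrow> bool" where
  "dqs G \<longleftrightarrow> (\<forall>H :: nat pair_pre_digraph. pair_graph H \<longrightarrow> q_cospectral H G \<longrightarrow> H \<simeq> G)"


lemma pair_graphI:
  assumes "finite (pverts G)" "parcs G \<subseteq> pverts G \<times> pverts G"
    and "\<And>u v. (u,v) \<in> parcs G \<Longrightarrow> (v,u) \<in> parcs G" "\<And>u. (u,u) \<notin> parcs G"
  shows "pair_graph G"
proof -
  have "finite (parcs G)" using assms(1,2) by (meson finite_SigmaI finite_subset)
  then show ?thesis using assms
    by unfold_locales (auto simp: symmetric_def sym_def)
qed

lemma pair_graphD:
  assumes "pair_graph G"
  shows "finite (pverts G)" "parcs G \<subseteq> pverts G \<times> pverts G"
    and "(u,v) \<in> parcs G \<Longrightarrow> (v,u) \<in> parcs G" "(u,u) \<notin> parcs G"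
proof -
  interpret pair_graph G by fact
  show "finite (pverts G)" by (rule pair_finite_verts)
  show "parcs G \<subseteq> pverts G \<times> pverts G" by (auto dest: in_arcsD1 in_arcsD2)
  show "(u,v) \<in> parcs G \<Longrightarrow> (v,u) \<in> parcs G"
    using pair_sym_arcs by (auto simp: symmetric_def sym_def)
  show "(u,u) \<notin> parcs G" using pair_no_loops by force
qed

lemma pair_graph_complete_graph: "pair_graph (complete_graph n)"
  by (rule pair_graphI) (auto simp: complete_graph_def)

lemma pair_graph_path_graph: "pair_graph (path_graph n)"
  by (rule pair_graphI) (auto simp: path_graph_def)

lemma pair_graph_cycle_graph: "n \<ge> 3 \<Longrightarrow> pair_graph (cycle_graph n)"
  by (rule pair_graphI) (auto simp: cycle_graph_def mod_Suc)

lemma pair_graph_disj_union: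
  assumes "pair_graph G" "pair_graph H" shows "pair_graph (G \<squnion>\<^sub>g H)"
  by (rule pair_graphI) (use pair_graphD[OF assms(1)] pair_graphD[OF assms(2)] in
    \<open>force simp: disj_union_def\<close>)+

lemma pair_graph_graph_join:
  assumes "pair_graph G" "pair_graph H" shows "pair_graph (G \<or>\<^sub>g H)"
  by (rule pair_graphI) (use pair_graphD[OF assms(1)] pair_graphD[OF assms(2)] in
    \<open>force simp: graph_join_def disj_union_def\<close>)+

lemma pair_graph_copies:
  assumes "pair_graph H" shows "pair_graph (r \<cdot>\<^sub>g H)"
  by (rule pair_graphI) (use pair_graphD[OF assms] in \<open>force simp: copies_def\<close>)+

lemma arc_image_iff:
  assumes "inj_on f V" "E \<subseteq> V \<times> V" "u \<in> V" "v \<in> V"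
  shows "(f u, f v) \<in> map_prod f f ` E \<longleftrightarrow> (u,v) \<in> E"
proof
  assume "(f u, f v) \<in> map_prod f f ` E"
  then obtain x y where xy: "(x,y) \<in> E" "f u = f x" "f v = f y" by auto
  then have "u = x" "v = y" using assms by (auto dest: inj_onD)
  then show "(u,v) \<in> E" using xy by simp
qed force

lemma graph_iso_iff:
  assumes G: "pair_graph G" and H: "pair_graph H"
  shows "G \<simeq> H \<longleftrightarrow> (\<exists>f. bij_betw f (pverts G) (pverts H) \<and>
    (\<forall>u\<in>pverts G. \<forall>v\<in>pverts G. (u,v) \<in> parcs G \<longleftrightarrow> (f u, f v) \<in> parcs H))"
    (is "?L \<longleftrightarrow> ?R")
proof
  assume ?L
  then obtain h where h: "pre_digraph.digraph_isomorphism (with_proj G) h"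
    and eq: "with_proj H = app_iso h (with_proj G)" by (auto simp: digraph_iso_def)
  have V: "pverts H = iso_verts h ` pverts G" and E: "parcs H = iso_arcs h ` parcs G"
    and T: "iso_tail h = fst" and D: "iso_head h = snd"
    using arg_cong[OF eq, of verts] arg_cong[OF eq, of arcs]
      arg_cong[OF eq, of tail] arg_cong[OF eq, of head] by auto
  have inj: "inj_on (iso_verts h) (pverts G)"
    and arc: "\<And>a. a \<in> parcs G \<Longrightarrow> iso_arcs h a = (iso_verts h (fst a), iso_verts h (snd a))"
    using h unfolding pre_digraph.digraph_isomorphism_def by (auto simp: T D prod_eq_iff)
  have E': "parcs H = (\<lambda>a. (iso_verts h (fst a), iso_verts h (snd a))) ` parcs G"
    unfolding E using arc by (intro image_cong) auto
  show ?R
  proof (intro exI[of _ "iso_verts h"] conjI ballI)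
    show "bij_betw (iso_verts h) (pverts G) (pverts H)" using inj V by (auto simp: bij_betw_def)
    fix u v assume "u \<in> pverts G" "v \<in> pverts G"
    then show "(u,v) \<in> parcs G \<longleftrightarrow> (iso_verts h u, iso_verts h v) \<in> parcs H"
      unfolding E' using arc_image_iff[OF inj pair_graphD(2)[OF G]]
      by (simp add: map_prod_def case_prod_beta)
  qed
next
  assume ?R
  then obtain f where f: "bij_betw f (pverts G) (pverts H)"
    and e: "\<And>u v. u \<in> pverts G \<Longrightarrow> v \<in> pverts G \<Longrightarrow> (u,v) \<in> parcs G \<longleftrightarrow> (f u, f v) \<in> parcs H"
    by blast
  define h where "h = \<lparr> iso_verts = f, iso_arcs = map_prod f f, iso_head = snd, iso_tail = fst \<rparr>"
  have inj: "inj_on f (pverts G)" and im: "f ` pverts G = pverts H"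
    using f by (auto simp: bij_betw_def)
  have "inj_on (map_prod f f) (parcs G)"
    by (rule inj_on_subset[OF map_prod_inj_on[OF inj inj] pair_graphD(2)[OF G]])
  moreover have "wf_digraph (with_proj G)"
    using pair_graphD(2)[OF G] by unfold_locales auto
  ultimately have "pre_digraph.digraph_isomorphism (with_proj G) h"
    using inj unfolding pre_digraph.digraph_isomorphism_def by (auto simp: h_def)
  moreover have "map_prod f f ` parcs G = parcs H"
  proof (intro equalityI subsetI)
    fix a assume "a \<in> map_prod f f ` parcs G"
    then show "a \<in> parcs H" using e pair_graphD(2)[OF G] by force
  next
    fix a assume a: "a \<in> parcs H"
    then have "a \<in> f ` pverts G \<times> f ` pverts G" using pair_graphD(2)[OF H] im by auto
    then obtain u v where "a = (f u, f v)" "u \<in> pverts G" "v \<in> pverts G" by auto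
    then show "a \<in> map_prod f f ` parcs G" using e a by force
  qed
  then have "with_proj H = app_iso h (with_proj G)"
    using im by (simp add: with_proj_def app_iso_def h_def)
  ultimately show ?L unfolding digraph_iso_def by blast
qed

lemma det_reindex:
  fixes A :: "'a :: comm_ring_1 mat"
  assumes A: "A \<in> carrier_mat n n" and p: "p permutes {0..<n}"
  shows "det (mat n n (\<lambda>(i,j). A $$ (p i, p j))) = det A"
proof -
  have pn: "\<And>i. i < n \<Longrightarrow> p i < n" using permutes_in_image[OF p] by auto
  define C where "C = mat n n (\<lambda>(i,j). A $$ (p i, j))"
  have C: "C \<in> carrier_mat n n" by (simp add: C_def)
  have "det (mat n n (\<lambda>(i,j). A $$ (p i, p j))) = det (mat n n (\<lambda>(i,j). transpose_mat C $$ (p i, j)))"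
    by (subst det_transpose[symmetric, of _ n], simp,
        rule arg_cong[of _ _ det], rule eq_matI) (auto simp: C_def pn)
  also have "\<dots> = signof p * det (transpose_mat C)"
    by (rule det_permute_rows) (use C p in auto)
  also have "det (transpose_mat C) = det C" by (rule det_transpose[OF C])
  also have "det C = signof p * det A" unfolding C_def by (rule det_permute_rows[OF A p])
  finally show ?thesis by (simp add: sign_def)
qed

lemma char_poly_reindex:
  fixes A :: "'a :: comm_ring_1 mat"
  assumes A: "A \<in> carrier_mat n n" and p: "p permutes {0..<n}"
  shows "char_poly (mat n n (\<lambda>(i,j). A $$ (p i, p j))) = char_poly A"
proof -
  have pn: "\<And>i. i < n \<Longrightarrow> p i < n" using permutes_in_image[OF p] by auto
  have "char_poly_matrix (mat n n (\<lambda>(i,j). A $$ (p i, p j)))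
      = mat n n (\<lambda>(i,j). char_poly_matrix A $$ (p i, p j))"
    by (rule eq_matI)
      (use A in \<open>auto simp: char_poly_matrix_def pn dest: injD[OF permutes_inj[OF p]]\<close>)
  then show ?thesis unfolding char_poly_def 
    using det_reindex[OF char_poly_matrix_closed[OF A] p] by simp
qed

lemma signless_laplacian_carrier:
  "signless_laplacian G vs \<in> carrier_mat (length vs) (length vs)"
  by (simp add: signless_laplacian_def degree_matrix_def adjacency_matrix_def)

lemma vertex_enum:
  assumes "finite (pverts G)"
  shows "distinct (vertex_enum G)" "set (vertex_enum G) = pverts G"
proof -
  have "\<exists>vs. distinct vs \<and> set vs = pverts G" using finite_distinct_list[OF assms] by blast
  from someI_ex[OF this] show "distinct (vertex_enum G)" "set (vertex_enum G) = pverts G"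
    by (auto simp: vertex_enum_def)
qed

lemma q_spectrum_eq:
  assumes vs: "distinct vs" "set vs = pverts G"
  shows "q_spectrum G = proots (char_poly (signless_laplacian G vs))"
proof -
  let ?ws = "vertex_enum G"
  have ws: "distinct ?ws" "set ?ws = pverts G"
    using vertex_enum[of G] vs by (metis List.finite_set)+
  then have "mset ?ws = mset vs" using vs by (simp add: set_eq_iff_mset_eq_distinct[symmetric])
  then obtain p where p: "p permutes {..<length vs}" and pl: "permute_list p vs = ?ws"
    by (rule mset_eq_permutation)
  have len: "length ?ws = length vs" using pl[symmetric] by simp
  have nth: "\<And>i. i < length vs \<Longrightarrow> ?ws ! i = vs ! p i"
    using permute_list_nth[OF p] by (simp add: pl)
  have pn: "\<And>i. i < length vs \<Longrightarrow> p i < length vs" using permutes_in_image[OF p] by auto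
  have "signless_laplacian G ?ws
      = mat (length vs) (length vs) (\<lambda>(i,j). signless_laplacian G vs $$ (p i, p j))"
    by (rule eq_matI) (auto simp: signless_laplacian_def degree_matrix_def adjacency_matrix_def
        len nth pn dest: injD[OF permutes_inj[OF p]])
  then show ?thesis unfolding q_spectrum_def
    using char_poly_reindex[OF signless_laplacian_carrier, of p vs] p
    by (simp add: atLeast0LessThan)
qed

lemma out_degree_bij:
  assumes G: "pair_graph G" and H: "pair_graph H" and f: "bij_betw f (pverts G) (pverts H)"
    and e: "\<And>u v. u \<in> pverts G \<Longrightarrow> v \<in> pverts G \<Longrightarrow> (u,v) \<in> parcs G \<longleftrightarrow> (f u, f v) \<in> parcs H"
    and u: "u \<in> pverts G"
  shows "out_degree (with_proj H) (f u) = out_degree (with_proj G) u"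
proof -
  have inj: "inj_on f (pverts G)" and im: "f ` pverts G = pverts H"
    using f by (auto simp: bij_betw_def)
  have "bij_betw (map_prod f f) {a \<in> parcs G. fst a = u} {a \<in> parcs H. fst a = f u}"
    unfolding bij_betw_def
  proof
    show "inj_on (map_prod f f) {a \<in> parcs G. fst a = u}"
      by (rule inj_on_subset[OF map_prod_inj_on[OF inj inj]]) (use pair_graphD(2)[OF G] in auto)
    show "map_prod f f ` {a \<in> parcs G. fst a = u} = {a \<in> parcs H. fst a = f u}"
    proof (intro equalityI subsetI)
      fix a assume "a \<in> map_prod f f ` {a \<in> parcs G. fst a = u}"
      then show "a \<in> {a \<in> parcs H. fst a = f u}" using e pair_graphD(2)[OF G] by force
    next
      fix a assume a: "a \<in> {a \<in> parcs H. fst a = f u}"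
      then have "snd a \<in> f ` pverts G" using pair_graphD(2)[OF H] im by auto
      then obtain v where v: "v \<in> pverts G" "a = (f u, f v)" using a by (cases a) auto
      then have "(u,v) \<in> parcs G" using e u a by auto
      then show "a \<in> map_prod f f ` {a \<in> parcs G. fst a = u}" using v by force
    qed
  qed
  then show ?thesis by (simp add: out_degree_def out_arcs_def bij_betw_same_card)
qed

lemma graph_iso_imp_q_cospectral:
  assumes G: "pair_graph G" and H: "pair_graph H" and "G \<simeq> H"
  shows "q_cospectral G H"
proof -
  obtain f where f: "bij_betw f (pverts G) (pverts H)"
    and e: "\<And>u v. u \<in> pverts G \<Longrightarrow> v \<in> pverts G \<Longrightarrow> (u,v) \<in> parcs G \<longleftrightarrow> (f u, f v) \<in> parcs H"
    using assms(3) unfolding graph_iso_iff[OF G H] by blast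
  obtain vs where vs: "distinct vs" "set vs = pverts G"
    using vertex_enum[OF pair_graphD(1)[OF G]] by blast
  have ws: "distinct (map f vs)" "set (map f vs) = pverts H"
    using vs f by (auto simp: distinct_map bij_betw_def)
  have mem: "\<And>i. i < length vs \<Longrightarrow> vs ! i \<in> pverts G" using vs(2) nth_mem by blast
  have "signless_laplacian H (map f vs) = signless_laplacian G vs"
    by (rule eq_matI) (auto simp: signless_laplacian_def degree_matrix_def adjacency_matrix_def
        mem e[symmetric] out_degree_bij[OF G H f e])
  then show ?thesis
    by (simp add: q_cospectral_def q_spectrum_eq[OF vs] q_spectrum_eq[OF ws])
qed

lemma dqsD:
  fixes H :: "'b pair_pre_digraph"
  assumes "dqs G" and G: "pair_graph G" and H: "pair_graph H" and "q_cospectral H G"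
  shows "H \<simeq> G"
proof -
  obtain f :: "'b \<Rightarrow> nat" where inj: "inj_on f (pverts H)"
    using finite_imp_inj_to_nat_seg[OF pair_graphD(1)[OF H]] by blast
  define H' where "H' = \<lparr> pverts = f ` pverts H, parcs = map_prod f f ` parcs H \<rparr>"
  note gH = pair_graphD[OF H]
  have H': "pair_graph H'"
  proof (rule pair_graphI)
    show "(u,u) \<notin> parcs H'" for u
      using gH(2,4) inj by (auto simp: H'_def dest!: inj_onD subsetD)
  qed (use gH(1-3) in \<open>force simp: H'_def\<close>)+
  have f: "bij_betw f (pverts H) (pverts H')" using inj by (simp add: H'_def bij_betw_def)
  have e: "(u,v) \<in> parcs H \<longleftrightarrow> (f u, f v) \<in> parcs H'" if "u \<in> pverts H" "v \<in> pverts H" for u v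
    using arc_image_iff[OF inj gH(2) that] by (simp add: H'_def)
  have "H \<simeq> H'" unfolding graph_iso_iff[OF H H'] using f e by blast
  then have "q_cospectral H' G"
    using graph_iso_imp_q_cospectral[OF H H'] assms(4) by (simp add: q_cospectral_def)
  then have "H' \<simeq> G" using assms(1) H' by (simp add: dqs_def)
  then obtain g where g: "bij_betw g (pverts H') (pverts G)"
    and e': "\<And>u v. u \<in> pverts H' \<Longrightarrow> v \<in> pverts H' \<Longrightarrow> (u,v) \<in> parcs H' \<longleftrightarrow> (g u, g v) \<in> parcs G"
    unfolding graph_iso_iff[OF H' G] by blast
  have "bij_betw (g \<circ> f) (pverts H) (pverts G)" using f g by (rule bij_betw_trans)
  moreover have "(u,v) \<in> parcs H \<longleftrightarrow> ((g \<circ> f) u, (g \<circ> f) v) \<in> parcs G"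
    if "u \<in> pverts H" "v \<in> pverts H" for u v
    using e[OF that] e' that by (simp add: H'_def)
  ultimately show ?thesis unfolding graph_iso_iff[OF H G] by blast
qed

end

theory Submission
  imports Defs "HOL-Analysis.Function_Topology" "Jordan_Normal_Form.Schur_Decomposition"
begin

text \<open>
  Put \<open>N = k + 2q + s\<close> and let \<open>F\<close> be \<open>Q\<close>-cospectral with
  \<open>G = K\<^sub>1 \<or> (C\<^sub>k \<union> qK\<^sub>2 \<union> sK\<^sub>1)\<close>. For every \<open>k \<ge> 4\<close>, odd or even, the conclusion is \<open>F \<simeq> G\<close>
  (\<open>determined_by_q_spectrum\<close>). The spectrum is used in two ways only: its power sums give the number
  of vertices, the first two moments of the degrees, and the third moment plus six times the number
  of triangles; and its real members are the \<open>\<theta>\<close> for which \<open>Q\<close> has an eigenvector.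

  Eliminating the coordinates outside the apex shows that \<open>\<theta> > 5\<close> is an eigenvalue of \<open>G\<close> if and only
  if it solves the secular equation \<open>\<theta> - N = k/(\<theta> - 5) + 2q/(\<theta> - 3) + s/(\<theta> - 1)\<close>. There is exactly one such
  root \<open>\<mu>\<close>, it exceeds \<open>N\<close>, and \<open>5\<close> itself is not an eigenvalue. So \<open>\<mu>\<close> is the only eigenvalue
  \<open>\<ge> 5\<close>.

  Two vertices of degree at least 6 in \<open>F\<close> would span a plane on which the Rayleigh quotient is at
  least 5, and hence yield an eigenvector orthogonal to the one for \<open>\<mu>\<close> whose eigenvalue is at
  least 5, that is, \<open>\<mu>\<close> again. A double eigenvalue \<open>\<mu> > N\<close> contradicts the trace of \<open>Q\<^sup>2\<close>. Hence all
  vertices but one have degree at most 5, and the moments then force the remaining vertex to be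
  adjacent to all others (\<open>dominating_vertex\<close>); the estimate there needs \<open>N \<ge> 20\<close>, that is, 21
  vertices. So \<open>F = K\<^sub>1 \<or> H\<close>.

  With \<open>h\<close> for degrees in \<open>H\<close>, the moments combine to \<open>\<Sum>h(h-1)(h-2) + 6t(H) = 0\<close>. So \<open>H\<close> has
  maximum degree at most 2, and \<open>k\<close>, \<open>2q\<close>, \<open>s\<close> vertices of degree 2, 1, 0: it is a union of cycles,
  \<open>q\<close> paths with at least one edge, and isolated vertices. Two facts finish the proof. If some path has
  more than one edge, then no eigenvalue of \<open>F\<close> solves the secular equation
  (\<open>same_degree_of_secular\<close>), against \<open>\<mu>\<close> being one; so all paths are single edges. If there are
  several cycles, then 5 is an eigenvalue of \<open>F\<close> (\<open>rim_connected\<close>); so the \<open>k\<close> vertices of degree 2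
  form one cycle.
\<close>

section \<open>Traces of powers of a matrix\<close>

lemma mult_mat_entry:
  assumes "A \<in> carrier_mat n n" "B \<in> carrier_mat n n" "i < n" "j < n"
  shows "(A * B) $$ (i,j) = (\<Sum>l<n. A $$ (i,l) * B $$ (l,j))"
  using assms by (auto simp: scalar_prod_def atLeast0LessThan)

lemma trace_mult_commute:
  fixes A B :: "'a :: comm_ring_1 mat"
  assumes "A \<in> carrier_mat n n" "B \<in> carrier_mat n n"
  shows "(\<Sum>i<n. (A * B) $$ (i,i)) = (\<Sum>i<n. (B * A) $$ (i,i))"
proof -
  have "(\<Sum>i<n. (A * B) $$ (i,i)) = (\<Sum>i<n. \<Sum>j<n. A $$ (i,j) * B $$ (j,i))"
    using assms by (intro sum.cong refl) (auto simp: scalar_prod_def atLeast0LessThan)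
  also have "\<dots> = (\<Sum>j<n. \<Sum>i<n. B $$ (j,i) * A $$ (i,j))"
    by (subst sum.swap) (simp add: mult.commute)
  also have "\<dots> = (\<Sum>i<n. (B * A) $$ (i,i))"
    using assms by (intro sum.cong refl) (auto simp: scalar_prod_def atLeast0LessThan)
  finally show ?thesis .
qed

lemma upper_triangular_pow:
  fixes B :: "'a :: comm_ring_1 mat"
  assumes B: "B \<in> carrier_mat n n" and ut: "upper_triangular B"
  shows "upper_triangular (B ^\<^sub>m k)" and "i < n \<Longrightarrow> (B ^\<^sub>m k) $$ (i,i) = (B $$ (i,i)) ^ k"
proof -
  have "upper_triangular (B ^\<^sub>m k) \<and> (\<forall>i<n. (B ^\<^sub>m k) $$ (i,i) = (B $$ (i,i)) ^ k)"
  proof (induction k)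
    case 0
    then show ?case using B by auto
  next
    case (Suc k)
    let ?C = "B ^\<^sub>m k"
    have C: "?C \<in> carrier_mat n n" using B by auto
    have entry: "(?C * B) $$ (i,j) = (\<Sum>l\<in>{0..<n}. ?C $$ (i,l) * B $$ (l,j))" if "i < n" "j < n" for i j
      using that B C by (auto simp: scalar_prod_def)
    have z: "?C $$ (i,l) * B $$ (l,j) = 0" if "i < n" "l < n" "j \<le> i" "l \<noteq> i \<or> j \<noteq> i" for i j l
    proof (cases "l < i")
      case True
      then show ?thesis using Suc C that by (auto simp: upper_triangular_def)
    next
      case False
      then have "j < l" using that by auto
      then show ?thesis using ut B that by (auto simp: upper_triangular_def)
    qed
    have "(?C * B) $$ (i,j) = 0" if "i < n" "j < i" for i j
      using that entry[of i j] z[of i _ j] by (auto intro!: sum.neutral)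
    moreover have "(?C * B) $$ (i,i) = ?C $$ (i,i) * B $$ (i,i)" if "i < n" for i
    proof -
      have "(?C * B) $$ (i,i) = ?C $$ (i,i) * B $$ (i,i) + (\<Sum>l\<in>{0..<n}-{i}. ?C $$ (i,l) * B $$ (l,i))"
        unfolding entry[OF that that] by (rule sum.remove) (use that in auto)
      also have "(\<Sum>l\<in>{0..<n}-{i}. ?C $$ (i,l) * B $$ (l,i)) = 0"
        using that z[of i _ i] by (intro sum.neutral) auto
      finally show ?thesis by simp
    qed
    ultimately show ?case using Suc B C by (auto simp: upper_triangular_def)
  qed
  then show "upper_triangular (B ^\<^sub>m k)" and "i < n \<Longrightarrow> (B ^\<^sub>m k) $$ (i,i) = (B $$ (i,i)) ^ k" by auto
qed

text \<open>A Schur triangularisation has the eigenvalues on its diagonal, and powers of triangular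
  matrices have the powers of the diagonal entries on theirs.\<close>

lemma trace_pow_eq_sum_eigenvalues:
  fixes A :: "complex mat"
  assumes A: "A \<in> carrier_mat n n"
  shows "(\<Sum>i<n. (A ^\<^sub>m k) $$ (i,i)) = (\<Sum>x\<in>#proots (char_poly A). x ^ k)"
proof -
  obtain es where es: "char_poly A = (\<Prod>e\<leftarrow>es. [:- e, 1:])" and len: "length es = n"
    using char_poly_factorized[OF A] by blast
  obtain B P Q where BPQ: "schur_decomposition A es = (B,P,Q)" by (cases "schur_decomposition A es")
  note sd = schur_decomposition[OF A es BPQ]
  have carr: "B \<in> carrier_mat n n" "P \<in> carrier_mat n n" "Q \<in> carrier_mat n n" and QP: "Q * P = 1\<^sub>m n"
    using sd A by (auto simp: similar_mat_wit_def Let_def)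
  have pow: "A ^\<^sub>m k = P * (B ^\<^sub>m k * Q)"
    using similar_mat_wit_pow_id[of A B P Q k] sd carr
    by (auto simp: assoc_mult_mat[of _ n n _ n _ n])
  have "(\<Sum>i<n. (A ^\<^sub>m k) $$ (i,i)) = (\<Sum>i<n. ((B ^\<^sub>m k * Q) * P) $$ (i,i))"
    unfolding pow by (rule trace_mult_commute) (use carr in auto)
  also have "(B ^\<^sub>m k * Q) * P = B ^\<^sub>m k"
    using carr QP assoc_mult_mat[of "B ^\<^sub>m k" n n Q n P n] by auto
  also have "(\<Sum>i<n. (B ^\<^sub>m k) $$ (i,i)) = (\<Sum>i<n. (es ! i) ^ k)"
  proof (rule sum.cong)
    fix i assume i: "i \<in> {..<n}"
    have "B $$ (i,i) = es ! i" using sd carr i by (auto simp: diag_mat_def)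
    then show "(B ^\<^sub>m k) $$ (i,i) = (es ! i) ^ k" using upper_triangular_pow(2)[OF carr(1)] sd i by auto
  qed simp
  also have "\<dots> = (\<Sum>x\<in>#mset es. x ^ k)"
    using len by (simp add: sum_mset_sum_list sum_list_sum_nth atLeast0LessThan flip: mset_map)
  also have "mset es = proots (char_poly A)"
  proof -
    have "proots (\<Prod>e\<leftarrow>xs. [:- e, 1:]) = mset xs" for xs :: "complex list"
    proof (induction xs)
      case (Cons e xs)
      have "(\<Prod>e\<leftarrow>xs. [:- e, 1:]) \<noteq> 0" by (auto simp: prod_list_zero_iff)
      then show ?case using Cons by (simp add: proots_mult del: mult_pCons_left)
    qed simp
    then show ?thesis unfolding es by simp
  qed
  finally show ?thesis .
qed

section \<open>The signless Laplacian as an operator on functions\<close>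

locale simple_graph =
  fixes G :: "'a pair_pre_digraph"
  assumes pair_graph: "pair_graph G"
begin

abbreviation V where "V \<equiv> pverts G"
abbreviation adj where "adj u v \<equiv> (u,v) \<in> parcs G"

definition nbs where "nbs v = {w. adj v w}"
definition deg where "deg v = card (nbs v)"

text \<open>The entries of the signless Laplacian, indexed by vertices instead of positions in a list.\<close>

definition Q :: "'a \<Rightarrow> 'a \<Rightarrow> real" where
  "Q u v = (if u = v then real (deg u) else if adj u v then 1 else 0)"

lemma finite_V [simp]: "finite V"
  and adj_V: "adj u v \<Longrightarrow> u \<in> V \<and> v \<in> V"
  and adj_sym: "adj u v \<Longrightarrow> adj v u"
  and adj_irrefl [simp]: "\<not> adj u u"
  using pair_graphD[OF pair_graph] by auto

lemma adj_commute: "adj u v \<longleftrightarrow> adj v u"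
  using adj_sym by blast

lemma finite_nbs [simp]: "finite (nbs v)"
  and mem_nbs [simp]: "w \<in> nbs v \<longleftrightarrow> adj v w"
proof -
  have "nbs v \<subseteq> V" using adj_V by (auto simp: nbs_def)
  then show "finite (nbs v)" by (rule finite_subset) simp
qed (simp add: nbs_def)

lemma Q_sym: "Q u v = Q v u"
  by (auto simp: Q_def adj_commute)

lemma Q_apply:
  assumes "v \<in> V"
  shows "(\<Sum>w\<in>V. Q v w * x w) = real (deg v) * x v + (\<Sum>w\<in>nbs v. x w)"
proof -
  have "(\<Sum>w\<in>V. Q v w * x w) = Q v v * x v + (\<Sum>w\<in>V-{v}. Q v w * x w)"
    using assms by (simp add: sum.remove)
  also have "(\<Sum>w\<in>V-{v}. Q v w * x w) = (\<Sum>w\<in>nbs v. x w)"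
    by (rule sum.mono_neutral_cong_right) (use adj_V in \<open>auto simp: Q_def\<close>)
  finally show ?thesis by (simp add: Q_def)
qed

definition eigenfun :: "real \<Rightarrow> ('a \<Rightarrow> real) \<Rightarrow> bool" where
  "eigenfun \<mu> x \<longleftrightarrow> (\<exists>v\<in>V. x v \<noteq> 0) \<and> (\<forall>v\<in>V. (\<Sum>w\<in>V. Q v w * x w) = \<mu> * x v)"

lemma out_degree_eq: "out_degree (with_proj G) v = deg v"
proof -
  have "out_arcs (with_proj G) v = Pair v ` nbs v" by (auto simp: out_arcs_def)
  then show ?thesis by (simp add: out_degree_def deg_def card_image inj_on_def)
qed

context
  fixes vs :: "'a list"
  assumes vs: "distinct vs" "set vs = V"
begin

lemma vs_bij: "bij_betw (\<lambda>i. vs ! i) {..<length vs} V"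
  using bij_betw_nth[OF vs(1) refl vs(2)[symmetric]] .

lemma sum_vs: "(\<Sum>i<length vs. f (vs ! i)) = (\<Sum>v\<in>V. f v)"
  using sum.reindex_bij_betw[OF vs_bij, of f] .

lemma signless_laplacian_entry:
  assumes "i < length vs" "j < length vs"
  shows "signless_laplacian G vs $$ (i,j) = of_real (Q (vs ! i) (vs ! j))"
  using assms vs
  by (auto simp: signless_laplacian_def degree_matrix_def adjacency_matrix_def out_degree_eq Q_def
      nth_eq_iff_index_eq)

lemma power_sums_vs:
  defines "L \<equiv> signless_laplacian G vs" and "n \<equiv> length vs"
  shows "(\<Sum>i<n. (L ^\<^sub>m 0) $$ (i,i)) = of_nat (card V)"
    and "(\<Sum>i<n. (L ^\<^sub>m 1) $$ (i,i)) = of_real (\<Sum>u\<in>V. Q u u)"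
    and "(\<Sum>i<n. (L ^\<^sub>m 2) $$ (i,i)) = of_real (\<Sum>u\<in>V. \<Sum>v\<in>V. Q u v * Q v u)"
    and "(\<Sum>i<n. (L ^\<^sub>m 3) $$ (i,i)) = of_real (\<Sum>u\<in>V. \<Sum>w\<in>V. (\<Sum>v\<in>V. Q u v * Q v w) * Q w u)"
proof -
  have L: "L \<in> carrier_mat n n" unfolding L_def n_def by (rule signless_laplacian_carrier)
  have e: "L $$ (i,j) = of_real (Q (vs ! i) (vs ! j))" if "i < n" "j < n" for i j
    using that signless_laplacian_entry by (auto simp: L_def n_def)
  have sums: "(\<Sum>i<n. f (vs ! i)) = (\<Sum>v\<in>V. f v)" for f :: "'a \<Rightarrow> complex" unfolding n_def by (rule sum_vs)
  have p2: "L ^\<^sub>m 2 = L * L" and p3: "L ^\<^sub>m 3 = L * L * L" and p1: "L ^\<^sub>m 1 = L"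
    using L by (simp_all add: numeral_2_eq_2 numeral_3_eq_3)
  have e2: "(L * L) $$ (i,j) = of_real (\<Sum>v\<in>V. Q (vs ! i) v * Q v (vs ! j))" if "i < n" "j < n" for i j
  proof -
    have "(L * L) $$ (i,j) = (\<Sum>l<n. of_real (Q (vs ! i) (vs ! l) * Q (vs ! l) (vs ! j)))"
      using that L by (auto simp: scalar_prod_def atLeast0LessThan e intro!: sum.cong)
    then show ?thesis using sums[of "\<lambda>v. of_real (Q (vs ! i) v * Q v (vs ! j))"] by simp
  qed
  have e3: "(L * L * L) $$ (i,j) = of_real (\<Sum>w\<in>V. (\<Sum>v\<in>V. Q (vs ! i) v * Q v w) * Q w (vs ! j))"
    if "i < n" "j < n" for i j
  proof -
    have "(L * L * L) $$ (i,j) = (\<Sum>l<n. (L * L) $$ (i,l) * L $$ (l,j))"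
      by (rule mult_mat_entry) (use that L in auto)
    also have "\<dots> = (\<Sum>l<n. of_real ((\<Sum>v\<in>V. Q (vs ! i) v * Q v (vs ! l)) * Q (vs ! l) (vs ! j)))"
      using that by (intro sum.cong) (auto simp: e e2)
    also have "\<dots> = (\<Sum>w\<in>V. of_real ((\<Sum>v\<in>V. Q (vs ! i) v * Q v w) * Q w (vs ! j)))"
      by (rule sums)
    finally show ?thesis by simp
  qed
  have "card V = n" using vs by (metis distinct_card n_def)
  then show "(\<Sum>i<n. (L ^\<^sub>m 0) $$ (i,i)) = of_nat (card V)" using L by simp
  show "(\<Sum>i<n. (L ^\<^sub>m 1) $$ (i,i)) = of_real (\<Sum>u\<in>V. Q u u)"
    unfolding p1 using sums[of "\<lambda>v. of_real (Q v v)"] by (simp add: e)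
  show "(\<Sum>i<n. (L ^\<^sub>m 2) $$ (i,i)) = of_real (\<Sum>u\<in>V. \<Sum>v\<in>V. Q u v * Q v u)"
    unfolding p2 using sums[of "\<lambda>u. of_real (\<Sum>v\<in>V. Q u v * Q v u)"] by (simp add: e2)
  show "(\<Sum>i<n. (L ^\<^sub>m 3) $$ (i,i)) = of_real (\<Sum>u\<in>V. \<Sum>w\<in>V. (\<Sum>v\<in>V. Q u v * Q v w) * Q w u)"
    unfolding p3 using sums[of "\<lambda>u. of_real (\<Sum>w\<in>V. (\<Sum>v\<in>V. Q u v * Q v w) * Q w u)"]
    by (simp add: e3)
qed

text \<open>A complex eigenvector for a real eigenvalue of a real matrix has a real or an imaginary part
  that is a nonzero real eigenvector.\<close>

lemma eigenvalue_vs: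
  "eigenvalue (signless_laplacian G vs) (of_real \<mu>) \<longleftrightarrow> (\<exists>x. eigenfun \<mu> x)"
proof
  let ?L = "signless_laplacian G vs" and ?n = "length vs"
  note L = signless_laplacian_carrier[of G vs]
  assume "eigenvalue ?L (of_real \<mu>)"
  then obtain y where y: "y \<in> carrier_vec ?n" "y \<noteq> 0\<^sub>v ?n" "?L *\<^sub>v y = of_real \<mu> \<cdot>\<^sub>v y"
    using L by (auto simp: eigenvalue_def eigenvector_def)
  define ix where "ix = inv_into {..<?n} (\<lambda>i. vs ! i)"
  have ix: "ix (vs ! i) = i" if "i < ?n" for i
    unfolding ix_def by (rule inv_into_f_f) (use that vs_bij in \<open>auto simp: bij_betw_def\<close>)
  define f where "f v = y $ (ix v)" for v
  have fnth: "f (vs ! i) = y $ i" if "i < ?n" for i using ix[OF that] by (simp add: f_def)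
  have f: "(\<Sum>w\<in>V. of_real (Q v w) * f w) = of_real \<mu> * f v" if "v \<in> V" for v
  proof -
    from that vs(2) have "v \<in> set vs" by simp
    then obtain i where i: "i < ?n" "v = vs ! i" by (auto simp: in_set_conv_nth)
    have "(\<Sum>w\<in>V. of_real (Q v w) * f w) = (\<Sum>j<?n. of_real (Q v (vs ! j)) * f (vs ! j))"
      by (rule sum_vs[symmetric])
    also have "\<dots> = (?L *\<^sub>v y) $ i"
      using i L y(1) by (auto simp: scalar_prod_def atLeast0LessThan signless_laplacian_entry fnth intro!: sum.cong)
    also have "\<dots> = of_real \<mu> * f v" using y(1) i by (simp add: y(3) fnth)
    finally show ?thesis .
  qed
  have "\<exists>i<?n. y $ i \<noteq> 0"
  proof (rule ccontr)
    assume "\<not> ?thesis"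
    then have "y = 0\<^sub>v ?n" using y(1) by (intro eq_vecI) auto
    then show False using y(2) by simp
  qed
  then obtain i where i: "i < ?n" "y $ i \<noteq> 0" by blast
  then have "f (vs ! i) \<noteq> 0" "vs ! i \<in> V" using vs(2) nth_mem[of i vs] by (simp_all add: fnth)
  moreover have "\<forall>v\<in>V. (\<Sum>w\<in>V. Q v w * Re (f w)) = \<mu> * Re (f v)"
    using f[THEN arg_cong[of _ _ Re]] by simp
  moreover have "\<forall>v\<in>V. (\<Sum>w\<in>V. Q v w * Im (f w)) = \<mu> * Im (f v)"
    using f[THEN arg_cong[of _ _ Im]] by simp
  moreover have "Re (f (vs ! i)) \<noteq> 0 \<or> Im (f (vs ! i)) \<noteq> 0"
    using \<open>f (vs ! i) \<noteq> 0\<close> by (simp add: complex_eq_iff)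
  ultimately have "eigenfun \<mu> (\<lambda>v. Re (f v)) \<or> eigenfun \<mu> (\<lambda>v. Im (f v))"
    unfolding eigenfun_def by blast
  then show "\<exists>x. eigenfun \<mu> x" by blast
next
  let ?L = "signless_laplacian G vs" and ?n = "length vs"
  note L = signless_laplacian_carrier[of G vs]
  assume "\<exists>x. eigenfun \<mu> x"
  then obtain x u where x: "\<And>v. v \<in> V \<Longrightarrow> (\<Sum>w\<in>V. Q v w * x w) = \<mu> * x v" and u: "u \<in> V" "x u \<noteq> 0"
    by (auto simp: eigenfun_def)
  define y where "y = vec ?n (\<lambda>i. complex_of_real (x (vs ! i)))"
  from u vs(2) have "u \<in> set vs" by simp
  then obtain i where i: "i < ?n" "u = vs ! i" by (auto simp: in_set_conv_nth)
  then have "y $ i \<noteq> 0" using u by (simp add: y_def)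
  then have "y \<noteq> 0\<^sub>v ?n" using i by auto
  moreover have "?L *\<^sub>v y = of_real \<mu> \<cdot>\<^sub>v y"
  proof (rule eq_vecI)
    fix i assume "i < dim_vec (of_real \<mu> \<cdot>\<^sub>v y)"
    then have i: "i < ?n" by (simp add: y_def)
    then have "(?L *\<^sub>v y) $ i = (\<Sum>j<?n. of_real (Q (vs ! i) (vs ! j) * x (vs ! j)))"
      using L by (auto simp: scalar_prod_def atLeast0LessThan signless_laplacian_entry y_def intro!: sum.cong)
    also have "\<dots> = (\<Sum>w\<in>V. of_real (Q (vs ! i) w * x w))" by (rule sum_vs)
    also have "\<dots> = of_real (\<Sum>w\<in>V. Q (vs ! i) w * x w)" by simp
    also have "\<dots> = of_real (\<mu> * x (vs ! i))"
      using i vs(2) nth_mem[of i vs] by (subst x) auto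
    finally show "(?L *\<^sub>v y) $ i = (of_real \<mu> \<cdot>\<^sub>v y) $ i" using i by (simp add: y_def)
  qed (use L in \<open>simp add: y_def\<close>)
  ultimately show "eigenvalue ?L (of_real \<mu>)"
    unfolding eigenvalue_def eigenvector_def using L by (intro exI[of _ y]) (auto simp: y_def)
qed

end

lemma q_spectrum_power_sums:
  shows "(\<Sum>x\<in>#q_spectrum G. x ^ 0) = of_nat (card V)"
    and "(\<Sum>x\<in>#q_spectrum G. x ^ 1) = of_real (\<Sum>u\<in>V. Q u u)"
    and "(\<Sum>x\<in>#q_spectrum G. x ^ 2) = of_real (\<Sum>u\<in>V. \<Sum>v\<in>V. Q u v * Q v u)"
    and "(\<Sum>x\<in>#q_spectrum G. x ^ 3) = of_real (\<Sum>u\<in>V. \<Sum>w\<in>V. (\<Sum>v\<in>V. Q u v * Q v w) * Q w u)"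
proof -
  obtain vs where vs: "distinct vs" "set vs = V" using vertex_enum[OF finite_V] by blast
  note * = power_sums_vs[OF vs] trace_pow_eq_sum_eigenvalues[OF signless_laplacian_carrier]
  show "(\<Sum>x\<in>#q_spectrum G. x ^ 0) = of_nat (card V)"
    and "(\<Sum>x\<in>#q_spectrum G. x ^ 1) = of_real (\<Sum>u\<in>V. Q u u)"
    and "(\<Sum>x\<in>#q_spectrum G. x ^ 2) = of_real (\<Sum>u\<in>V. \<Sum>v\<in>V. Q u v * Q v u)"
    and "(\<Sum>x\<in>#q_spectrum G. x ^ 3) = of_real (\<Sum>u\<in>V. \<Sum>w\<in>V. (\<Sum>v\<in>V. Q u v * Q v w) * Q w u)"
    unfolding q_spectrum_eq[OF vs] *(1-4)[symmetric] *(5) by (rule refl)+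
qed

lemma q_spectrum_real: "complex_of_real \<mu> \<in># q_spectrum G \<longleftrightarrow> (\<exists>x. eigenfun \<mu> x)"
proof -
  obtain vs where vs: "distinct vs" "set vs = V" using vertex_enum[OF finite_V] by blast
  let ?L = "signless_laplacian G vs"
  note L = signless_laplacian_carrier[of G vs]
  have "char_poly ?L \<noteq> 0" using degree_monic_char_poly[OF L] by auto
  then have "complex_of_real \<mu> \<in># q_spectrum G \<longleftrightarrow> eigenvalue ?L (of_real \<mu>)"
    by (simp add: q_spectrum_eq[OF vs] eigenvalue_root_char_poly[OF L])
  then show ?thesis using eigenvalue_vs[OF vs] by simp
qed

end

section \<open>Moments of the spectrum\<close>

context simple_graph begin

lemma sum_nbs_swap: "(\<Sum>u\<in>V. \<Sum>w\<in>nbs u. f u w) = (\<Sum>u\<in>V. \<Sum>w\<in>nbs u. f w u)"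
proof -
  have "(\<Sum>u\<in>V. \<Sum>w\<in>nbs u. f u w) = (\<Sum>(u,w)\<in>parcs G. f u w)" for f :: "'a \<Rightarrow> 'a \<Rightarrow> 'b::comm_monoid_add"
    by (subst sum.Sigma) (use adj_V in \<open>auto intro!: sum.cong\<close>)
  moreover have "(\<Sum>(u,w)\<in>parcs G. f u w) = (\<Sum>(u,w)\<in>parcs G. f w u)"
    by (rule sum.reindex_bij_witness[of _ prod.swap prod.swap]) (auto intro: adj_sym)
  ultimately show ?thesis by metis
qed

lemma sum_nbs_deg: "(\<Sum>u\<in>V. \<Sum>w\<in>nbs u. g w) = (\<Sum>u\<in>V. real (deg u) * g u)"
  by (subst sum_nbs_swap) (simp add: deg_def)

text \<open>Ordered triples of mutually adjacent vertices, so six times the number of triangles.\<close>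

definition triangles :: nat where
  "triangles = (\<Sum>u\<in>V. \<Sum>w\<in>nbs u. card (nbs u \<inter> nbs w))"

lemma Q_diag [simp]: "Q u u = real (deg u)"
  and Q_adj: "adj u v \<Longrightarrow> Q u v = 1" "adj u v \<Longrightarrow> Q v u = 1"
  using adj_sym by (auto simp: Q_def)

lemma Q2_diag: "u \<in> V \<Longrightarrow> (\<Sum>v\<in>V. Q u v * Q v u) = real (deg u)^2 + real (deg u)"
  by (subst Q_apply) (simp_all add: Q_adj deg_def power2_eq_square)

lemma trace2: "(\<Sum>u\<in>V. \<Sum>v\<in>V. Q u v * Q v u) = (\<Sum>u\<in>V. real (deg u)^2 + real (deg u))"
  by (simp add: Q2_diag)

text \<open>A closed walk of length 3 in the graph with \<open>deg v\<close> loops at each \<open>v\<close> uses three loops, or one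
  loop and one edge back and forth, or goes round a triangle. In the second kind the loop is at the
  start of the edge (two positions) or at its other end (one position); after summation all three
  contribute \<open>deg\<^sup>2\<close>.\<close>

lemma trace3:
  "(\<Sum>u\<in>V. \<Sum>w\<in>V. (\<Sum>v\<in>V. Q u v * Q v w) * Q w u)
    = (\<Sum>u\<in>V. real (deg u)^3 + 3 * real (deg u)^2) + real triangles"
proof -
  have *: "(\<Sum>v\<in>V. Q u v * Q v w) = real (deg u) + real (deg w) + real (card (nbs u \<inter> nbs w))"
    if "u \<in> V" "w \<in> nbs u" for u w
  proof -
    have w: "w \<in> V" "adj u w" using that adj_V by auto
    have "(\<Sum>v\<in>nbs u. Q v w) = Q w w + (\<Sum>v\<in>nbs u - {w}. Q v w)"
      using w by (intro sum.remove) auto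
    also have "(\<Sum>v\<in>nbs u - {w}. Q v w) = (\<Sum>v\<in>nbs u \<inter> nbs w. 1)"
      by (rule sum.mono_neutral_cong_right) (auto simp: Q_def adj_commute)
    finally show ?thesis using that w by (subst Q_apply) (auto simp: Q_adj)
  qed
  have "(\<Sum>w\<in>V. (\<Sum>v\<in>V. Q u v * Q v w) * Q w u)
      = real (deg u)^3 + 2 * real (deg u)^2 + (\<Sum>w\<in>nbs u. real (deg w)) + (\<Sum>w\<in>nbs u. real (card (nbs u \<inter> nbs w)))"
    if u: "u \<in> V" for u
  proof -
    have "(\<Sum>w\<in>V. (\<Sum>v\<in>V. Q u v * Q v w) * Q w u) = (\<Sum>w\<in>V. Q u w * (\<Sum>v\<in>V. Q u v * Q v w))"
      by (simp add: Q_sym mult.commute)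
    also have "\<dots> = real (deg u) * (\<Sum>v\<in>V. Q u v * Q v u)
        + (\<Sum>w\<in>nbs u. real (deg u) + real (deg w) + real (card (nbs u \<inter> nbs w)))"
      using u by (subst Q_apply) (simp_all add: * Q_adj)
    also have "\<dots> = real (deg u)^3 + 2 * real (deg u)^2 + (\<Sum>w\<in>nbs u. real (deg w)) + (\<Sum>w\<in>nbs u. real (card (nbs u \<inter> nbs w)))"
      unfolding Q2_diag[OF u] by (simp add: sum.distrib power2_eq_square power3_eq_cube algebra_simps flip: deg_def)
    finally show ?thesis .
  qed
  then have "(\<Sum>u\<in>V. \<Sum>w\<in>V. (\<Sum>v\<in>V. Q u v * Q v w) * Q w u)
    = (\<Sum>u\<in>V. real (deg u)^3) + 2 * (\<Sum>u\<in>V. real (deg u)^2)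
      + (\<Sum>u\<in>V. \<Sum>w\<in>nbs u. real (deg w)) + real triangles"
    by (simp add: sum.distrib triangles_def flip: sum_distrib_left)
  also have "(\<Sum>u\<in>V. \<Sum>w\<in>nbs u. real (deg w)) = (\<Sum>u\<in>V. real (deg u)^2)"
    by (simp add: sum_nbs_deg power2_eq_square)
  finally show ?thesis by (simp add: sum.distrib flip: sum_distrib_left)
qed

section \<open>Rayleigh quotients\<close>

definition dot :: "('a \<Rightarrow> real) \<Rightarrow> ('a \<Rightarrow> real) \<Rightarrow> real" where
  "dot x y = (\<Sum>v\<in>V. x v * y v)"

definition Qf :: "('a \<Rightarrow> real) \<Rightarrow> 'a \<Rightarrow> real" where
  "Qf x v = (\<Sum>w\<in>V. Q v w * x w)"

lemma dot_commute: "dot x y = dot y x"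
  by (simp add: dot_def mult.commute)

lemma dot_add: "dot (\<lambda>v. a * x v + b * y v) z = a * dot x z + b * dot y z"
  by (simp add: dot_def algebra_simps sum.distrib sum_distrib_left)

lemma Qf_add: "Qf (\<lambda>v. a * x v + b * y v) = (\<lambda>v. a * Qf x v + b * Qf y v)"
  by (simp add: fun_eq_iff Qf_def algebra_simps sum.distrib sum_distrib_left)

lemma dot_cong: "(\<And>v. v \<in> V \<Longrightarrow> x v = x' v) \<Longrightarrow> (\<And>v. v \<in> V \<Longrightarrow> y v = y' v) \<Longrightarrow> dot x y = dot x' y'"
  by (simp add: dot_def)

lemma Qf_cong: "(\<And>v. v \<in> V \<Longrightarrow> x v = x' v) \<Longrightarrow> Qf x = Qf x'"
  by (simp add: Qf_def fun_eq_iff)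

lemma dot_nonneg: "0 \<le> dot x x"
  by (simp add: dot_def sum_nonneg)

lemma dot_eq_0: "dot x x = 0 \<longleftrightarrow> (\<forall>v\<in>V. x v = 0)"
  by (simp add: dot_def sum_nonneg_eq_0_iff)

lemma Q_selfadjoint: "dot (Qf x) y = dot x (Qf y)"
proof -
  have "dot (Qf x) y = (\<Sum>v\<in>V. \<Sum>w\<in>V. Q v w * x w * y v)"
    by (simp add: dot_def Qf_def sum_distrib_right)
  also have "\<dots> = (\<Sum>w\<in>V. \<Sum>v\<in>V. Q w v * x w * y v)"
    by (subst sum.swap) (simp add: Q_sym)
  also have "\<dots> = dot x (Qf y)"
    by (simp add: dot_def Qf_def sum_distrib_left mult_ac)
  finally show ?thesis .
qed

lemma eigenfun_iff: "eigenfun \<mu> x \<longleftrightarrow> dot x x > 0 \<and> (\<forall>v\<in>V. Qf x v = \<mu> * x v)"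
  using dot_eq_0[of x] dot_nonneg[of x] by (auto simp: eigenfun_def Qf_def less_le)

text \<open>With the value 0 fixed outside the vertex set, the unit sphere is a closed part of a product of
  compact intervals, and Tychonoff applies.\<close>

lemma compact_unit_sphere_orth:
  "compact {x. (\<forall>v. v \<notin> V \<longrightarrow> x v = 0) \<and> dot x x = 1 \<and> dot x p = 0}"
proof -
  define S where "S v = (if v \<in> V then {-1..1} else {0::real})" for v
  have "compactin (product_topology (\<lambda>_. euclidean) UNIV) (Pi\<^sub>E UNIV S)"
    by (subst compactin_PiE) (auto simp: S_def)
  then have box: "compact (Pi\<^sub>E UNIV S)" by (simp add: euclidean_product_topology)
  have c: "continuous_on UNIV (\<lambda>x. x v)" for v :: 'a
    by (rule continuous_on_product_coordinates)
  have "closed {x. dot x x = 1}" "closed {x. dot x p = 0}"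
    unfolding dot_def by (intro closed_Collect_eq continuous_intros c)+
  then have "compact (Pi\<^sub>E UNIV S \<inter> ({x. dot x x = 1} \<inter> {x. dot x p = 0}))"
    using box by (intro compact_Int_closed closed_Int)
  also have "Pi\<^sub>E UNIV S \<inter> ({x. dot x x = 1} \<inter> {x. dot x p = 0})
      = {x. (\<forall>v. v \<notin> V \<longrightarrow> x v = 0) \<and> dot x x = 1 \<and> dot x p = 0}"
  proof -
    have "x v \<in> {-1..1}" if "dot x x = 1" "v \<in> V" for x v
    proof -
      have "(x v)\<^sup>2 \<le> dot x x"
        unfolding dot_def power2_eq_square using that by (intro member_le_sum) auto
      then show ?thesis using that by (auto simp: abs_square_le_1 abs_le_iff)
    qed
    then show ?thesis by (auto simp: S_def PiE_def Pi_def split: if_splits)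
  qed
  finally show ?thesis .
qed

text \<open>The maximum \<open>\<theta>\<close> of the Rayleigh quotient over the unit vectors orthogonal to \<open>p\<close> is
  attained at some \<open>z\<close>. The residual
  \<open>r = \<theta> z - Q z\<close> is again orthogonal to \<open>p\<close>, so moving from \<open>z\<close> in the direction \<open>r\<close> cannot increase
  the quotient; the first-order term of that move is \<open>dot r r\<close>, which therefore vanishes.\<close>

lemma eigenfun_orthogonal_ge:
  assumes p: "eigenfun \<mu> p" and x: "dot x x > 0" "dot x p = 0" "dot x (Qf x) \<ge> c * dot x x"
  obtains \<theta> z where "\<theta> \<ge> c" "eigenfun \<theta> z" "dot z p = 0"
proof -
  define K where "K = {x. (\<forall>v. v \<notin> V \<longrightarrow> x v = 0) \<and> dot x x = 1 \<and> dot x p = 0}"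
  define f where "f x = dot x (Qf x)" for x
  have normalise: "\<exists>y\<in>K. f y = f x / dot x x" if x: "dot x x > 0" "dot x p = 0" for x
  proof -
    define s where "s = 1 / sqrt (dot x x)"
    have s2: "s * s = 1 / dot x x" using x by (simp add: s_def power_one_over flip: power2_eq_square)
    define x' where "x' = (\<lambda>v. s * x v + 0 * x v)"
    define y where "y = (\<lambda>v. if v \<in> V then x' v else 0)"
    have y: "dot y y = dot x' x'" "dot y p = dot x' p" "f y = f x'"
      using Qf_cong[of y x'] by (auto intro!: dot_cong simp: y_def f_def)
    have "dot x' u = s * dot x u" for u unfolding x'_def dot_add by simp
    moreover have "Qf x' = (\<lambda>v. s * Qf x v)" unfolding x'_def Qf_add by simp
    moreover have "dot x x' = s * dot x x" "dot x (\<lambda>v. s * Qf x v) = s * dot x (Qf x)"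
      by (simp_all add: x'_def dot_def sum_distrib_left mult_ac)
    ultimately have "dot x' x' = s * s * dot x x" "dot x' p = 0" "f x' = s * s * f x"
      using x by (simp_all add: f_def)
    then have "dot y y = 1" "dot y p = 0" "f y = f x / dot x x" using y x s2 by simp_all
    moreover have "\<forall>v. v \<notin> V \<longrightarrow> y v = 0" by (simp add: y_def)
    ultimately have "y \<in> K" "f y = f x / dot x x" by (simp_all add: K_def)
    then show ?thesis by blast
  qed
  have "continuous_on K f"
    unfolding f_def dot_def Qf_def
    by (intro continuous_intros continuous_on_subset[OF continuous_on_product_coordinates subset_UNIV])
  moreover have "K \<noteq> {}" using normalise[OF x(1,2)] by blast
  moreover have "compact K" unfolding K_def by (rule compact_unit_sphere_orth)
  ultimately obtain z where z: "z \<in> K" "\<And>y. y \<in> K \<Longrightarrow> f y \<le> f z"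
    using continuous_attains_sup[of K f] by blast
  have zz: "dot z z = 1" "dot z p = 0" using z by (auto simp: K_def)
  define \<theta> where "\<theta> = f z"
  have bound: "f y \<le> \<theta> * dot y y" if yp: "dot y p = 0" for y
  proof (cases "dot y y = 0")
    case True
    then have "f y = 0" using dot_eq_0[of y] by (simp add: f_def dot_def)
    then show ?thesis using True by simp
  next
    case False
    then have pos: "dot y y > 0" using dot_nonneg[of y] by simp
    obtain y' where "y' \<in> K" "f y' = f y / dot y y" using normalise[OF pos yp] by blast
    then have "f y / dot y y \<le> \<theta>" using z(2)[of y'] by (simp add: \<theta>_def)
    then show ?thesis using pos by (simp add: pos_divide_le_eq)
  qed
  have "c \<le> \<theta>"
  proof -
    have "c * dot x x \<le> \<theta> * dot x x" using bound[OF x(2)] x(3) by (simp add: f_def)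
    then show ?thesis using x(1) by simp
  qed
  define r where "r = (\<lambda>v. \<theta> * z v + (-1) * Qf z v)"
  have Qp: "dot u (Qf p) = \<mu> * dot u p" for u
    using p by (auto simp: eigenfun_iff dot_def sum_distrib_left intro!: sum.cong)
  have "dot r p = 0" unfolding r_def dot_add using zz Qp[of z] Q_selfadjoint[of z p] by simp
  define D where "D = dot r r"
  define C where "C = \<theta> * dot r r - f r"
  have C: "C \<ge> 0" using bound[OF \<open>dot r p = 0\<close>] by (simp add: C_def)
  have quad: "0 \<le> 2 * t * D + t * t * C" for t
  proof -
    define y where "y = (\<lambda>v. 1 * z v + t * r v)"
    have "dot y p = 0" unfolding y_def dot_add using zz \<open>dot r p = 0\<close> by simp
    from bound[OF this] have le: "dot y (Qf y) \<le> \<theta> * dot y y" by (simp add: f_def)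
    have yl: "dot y u = dot z u + t * dot r u" for u unfolding y_def dot_add by simp
    have yr: "dot u y = dot u z + t * dot u r" for u
      using yl[of u] by (simp add: dot_commute)
    have "dot y (Qf y) = dot (Qf y) y" by (rule dot_commute)
    also have "\<dots> = dot (Qf z) z + t * dot (Qf r) z + t * (dot (Qf z) r + t * dot (Qf r) r)"
      unfolding yr unfolding y_def Qf_add dot_add by (simp add: algebra_simps)
    also have "\<dots> = \<theta> + 2 * t * dot (Qf z) r + t * t * f r"
      using Q_selfadjoint[of z r] dot_commute[of z "Qf r"] dot_commute[of z "Qf z"] dot_commute[of r "Qf r"]
      by (simp add: \<theta>_def f_def algebra_simps)
    finally have yQy: "dot y (Qf y) = \<theta> + 2 * t * dot (Qf z) r + t * t * f r" .
    have yy: "dot y y = 1 + 2 * t * dot z r + t * t * D"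
      by (simp add: yl yr zz D_def dot_commute[of r z] algebra_simps)
    have "D = \<theta> * dot z r - dot (Qf z) r"
      unfolding D_def by (subst (1) r_def) (subst dot_add, simp)
    then have "dot (Qf z) r = \<theta> * dot z r - D" by simp
    from le[unfolded yQy yy this] show ?thesis by (simp add: C_def algebra_simps flip: D_def)
  qed
  have "D = 0"
  proof (rule ccontr)
    assume "D \<noteq> 0"
    then have D: "D > 0" using dot_nonneg[of r] by (simp add: D_def)
    \<comment> \<open>at \<open>t = - s\<close> the negative linear term outweighs the quadratic one\<close>
    define s where "s = D / (C + 1)"
    have s: "s > 0" "D = s * (C + 1)" using C D by (simp_all add: s_def)
    have "0 \<le> 2 * (- s) * D + (- s) * (- s) * C" by (rule quad)
    also have "\<dots> = - (s * s * (C + 2))" unfolding s(2) by (simp add: algebra_simps)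
    also have "\<dots> < 0" using s(1) C by simp
    finally show False by simp
  qed
  then have "\<forall>v\<in>V. r v = 0" using dot_eq_0 by (simp add: D_def)
  then have "eigenfun \<theta> z" using zz by (auto simp: eigenfun_iff r_def)
  then show ?thesis using that \<open>c \<le> \<theta>\<close> zz by blast
qed

text \<open>Bessel's inequality for an orthogonal pair: \<open>y\<close> is \<open>r\<close> minus its projection to the span.\<close>

lemma bessel_two:
  assumes "dot p z = 0" "dot p p > 0" "dot z z > 0"
  shows "(dot r p)\<^sup>2 / dot p p + (dot r z)\<^sup>2 / dot z z \<le> dot r r"
proof -
  define \<alpha> \<beta> where "\<alpha> = dot r p / dot p p" and "\<beta> = dot r z / dot z z"
  define y where "y = (\<lambda>v. 1 * r v + (-1) * (\<alpha> * p v + \<beta> * z v))"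
  have l: "dot y u = dot r u - (\<alpha> * dot p u + \<beta> * dot z u)" for u
    unfolding y_def dot_add by simp
  have "dot y p = 0" "dot y z = 0" using assms by (simp_all add: l \<alpha>_def \<beta>_def dot_commute[of z p])
  then have "dot p y = 0" "dot z y = 0" by (simp_all only: dot_commute[of p y] dot_commute[of z y])
  then have "dot y y = dot r y" using l[of y] by simp
  also have "\<dots> = dot y r" by (rule dot_commute)
  also have "\<dots> = dot r r - (\<alpha> * dot r p + \<beta> * dot r z)"
    by (simp only: l dot_commute[of p r] dot_commute[of z r])
  finally show ?thesis using dot_nonneg[of y]
    by (simp add: \<alpha>_def \<beta>_def power2_eq_square)
qed

text \<open>Bessel's inequality for each row of \<open>Q\<close>; the rows have inner products \<open>\<mu> p u\<close> and \<open>\<mu> z u\<close>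
  with the two eigenvectors.\<close>

lemma two_eigenfun_trace2:
  assumes p: "eigenfun \<mu> p" and z: "eigenfun \<mu> z" and "dot p z = 0"
  shows "2 * \<mu>\<^sup>2 \<le> (\<Sum>u\<in>V. \<Sum>v\<in>V. Q u v * Q v u)"
proof -
  have pos: "dot p p > 0" "dot z z > 0" using p z by (auto simp: eigenfun_iff)
  have "(\<mu> * p u)\<^sup>2 / dot p p + (\<mu> * z u)\<^sup>2 / dot z z \<le> (\<Sum>v\<in>V. Q u v * Q v u)" if u: "u \<in> V" for u
  proof -
    have "dot (Q u) p = \<mu> * p u" "dot (Q u) z = \<mu> * z u" "dot (Q u) (Q u) = (\<Sum>v\<in>V. Q u v * Q v u)"
      using p z u by (auto simp: eigenfun_iff dot_def Qf_def Q_sym)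
    then show ?thesis using bessel_two[OF assms(3) pos, of "Q u"] by simp
  qed
  then have "(\<Sum>u\<in>V. (\<mu> * p u)\<^sup>2 / dot p p + (\<mu> * z u)\<^sup>2 / dot z z) \<le> (\<Sum>u\<in>V. \<Sum>v\<in>V. Q u v * Q v u)"
    by (rule sum_mono)
  also have "(\<Sum>u\<in>V. (\<mu> * p u)\<^sup>2 / dot p p + (\<mu> * z u)\<^sup>2 / dot z z)
      = \<mu>\<^sup>2 * dot p p / dot p p + \<mu>\<^sup>2 * dot z z / dot z z"
    by (simp add: sum.distrib power_mult_distrib power2_eq_square dot_def sum_distrib_left sum_divide_distrib mult_ac)
  finally show ?thesis using pos by simp
qed


text \<open>On functions supported at \<open>u\<close> and \<open>v\<close> the quadratic form of \<open>Q\<close> is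
  \<open>deg u \<cdot> a\<^sup>2 + deg v \<cdot> b\<^sup>2 + 2 Q u v \<cdot> ab\<close>, at least \<open>(6 - 1)(a\<^sup>2 + b\<^sup>2)\<close>, and one of these functions is
  orthogonal to \<open>p\<close>.\<close>

lemma large_degree_unique:
  assumes p: "eigenfun \<mu> p" and only: "\<And>\<theta> x. eigenfun \<theta> x \<Longrightarrow> \<theta> \<ge> 5 \<Longrightarrow> \<theta> = \<mu>"
    and tr: "(\<Sum>u\<in>V. \<Sum>v\<in>V. Q u v * Q v u) < 2 * \<mu>\<^sup>2"
    and uv: "u \<in> V" "v \<in> V" "u \<noteq> v" and deg: "deg u \<ge> 6" "deg v \<ge> 6"
  shows False
proof -
  \<comment> \<open>a nonzero pair with \<open>a p u + b p v = 0\<close>\<close>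
  define a b where "a = (if p u = 0 \<and> p v = 0 then 1 else p v)"
    and "b = (if p u = 0 \<and> p v = 0 then 0 else - p u)"
  define x where "x w = (if w = u then a else if w = v then b else 0)" for w
  have xs: "(\<Sum>w\<in>V. x w * g w) = a * g u + b * g v" for g
  proof -
    have "(\<Sum>w\<in>V. x w * g w) = (\<Sum>w\<in>{u,v}. x w * g w)"
      by (rule sum.mono_neutral_right) (use uv in \<open>auto simp: x_def\<close>)
    then show ?thesis using uv by (auto simp: x_def)
  qed
  have xx: "dot x x = a\<^sup>2 + b\<^sup>2" using uv by (simp add: dot_def xs power2_eq_square) (simp add: x_def)
  have Qx: "Qf x w = a * Q w u + b * Q w v" for w
    using xs[of "Q w"] by (simp add: Qf_def mult.commute)
  have ab: "a\<^sup>2 + b\<^sup>2 > 0" by (auto simp: a_def b_def sum_power2_gt_zero_iff)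
  have "dot x (Qf x) = deg u * a\<^sup>2 + deg v * b\<^sup>2 + 2 * Q u v * (a * b)"
    unfolding dot_def xs Qx by (simp add: Q_sym[of v u] power2_eq_square algebra_simps)
  moreover have "2 * Q u v * (a * b) \<ge> - (a\<^sup>2 + b\<^sup>2)"
  proof -
    have "0 \<le> (a + b)\<^sup>2" by simp
    then have "2 * (a * b) \<ge> - (a\<^sup>2 + b\<^sup>2)" by (simp add: power2_sum)
    moreover have "Q u v = 0 \<or> Q u v = 1" using uv by (simp add: Q_def)
    ultimately show ?thesis using ab by auto
  qed
  moreover have "deg u * a\<^sup>2 \<ge> 6 * a\<^sup>2" "deg v * b\<^sup>2 \<ge> 6 * b\<^sup>2"
    using deg by (simp_all add: mult_right_mono)
  ultimately have "dot x (Qf x) \<ge> 5 * dot x x" using xx by simp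
  moreover have "dot x p = 0" unfolding dot_def xs by (simp add: a_def b_def)
  ultimately obtain \<theta> z where z: "\<theta> \<ge> 5" "eigenfun \<theta> z" "dot z p = 0"
    using eigenfun_orthogonal_ge[OF p, of x 5] xx ab by auto
  then have "eigenfun \<mu> z" using only by blast
  from two_eigenfun_trace2[OF p this] z(3) tr show False by (simp add: dot_commute)
qed

end

section \<open>A vertex adjacent to all others\<close>

context simple_graph begin

text \<open>The bracket is \<open>2e\<close> with \<open>e\<close> the number of edges that avoid \<open>z\<close>. Among the ordered triples, those with
  \<open>z\<close> in first or in second place come to at most \<open>2e\<close> each, and an ordered edge that avoids \<open>z\<close> has at
  most four common neighbours, \<open>z\<close> included.\<close>

lemma triangles_le:
  assumes z: "z \<in> V" and deg: "\<And>v. v \<in> V \<Longrightarrow> v \<noteq> z \<Longrightarrow> deg v \<le> 5"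
  shows "real triangles \<le> 6 * ((\<Sum>v\<in>V-{z}. real (deg v)) - real (deg z))"
proof -
  define e where "e = (\<Sum>u\<in>V-{z}. card (nbs u - {z}))"
  have nz: "nbs z \<subseteq> V - {z}" using adj_V by auto
  have "deg u = card (nbs u - {z}) + (if u \<in> nbs z then 1 else 0)" for u
  proof -
    have "z \<in> nbs u \<longleftrightarrow> u \<in> nbs z" using adj_sym by auto
    then show ?thesis using card.remove[of "nbs u" z] by (cases "z \<in> nbs u") (auto simp: deg_def)
  qed
  then have "(\<Sum>u\<in>V-{z}. deg u) = (\<Sum>u\<in>V-{z}. card (nbs u - {z}) + (if u \<in> nbs z then 1 else 0))"
    by (rule sum.cong[OF refl])
  also have "\<dots> = e + (\<Sum>u\<in>V-{z}. if u \<in> nbs z then 1 else 0)"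
    by (simp add: sum.distrib e_def)
  also have "(\<Sum>u\<in>V-{z}. if u \<in> nbs z then 1 else 0) = (\<Sum>u\<in>nbs z. 1::nat)"
    by (rule sum.mono_neutral_cong_right) (use nz in auto)
  also have "\<dots> = deg z" by (simp add: deg_def)
  finally have e: "(\<Sum>u\<in>V-{z}. deg u) = e + deg z" .
  have at_z: "(\<Sum>w\<in>nbs z. card (nbs z \<inter> nbs w)) \<le> e"
  proof -
    have "(\<Sum>w\<in>nbs z. card (nbs z \<inter> nbs w)) \<le> (\<Sum>w\<in>nbs z. card (nbs w - {z}))"
      by (intro sum_mono card_mono) auto
    also have "\<dots> \<le> e" unfolding e_def by (rule sum_mono2) (use nz in auto)
    finally show ?thesis .
  qed
  have off_z: "(\<Sum>w\<in>nbs u. card (nbs u \<inter> nbs w)) \<le> 5 * card (nbs u - {z})" if u: "u \<in> V - {z}" for u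
  proof -
    have "(\<Sum>w\<in>nbs u. card (nbs u \<inter> nbs w))
        = (\<Sum>w\<in>nbs u - {z}. card (nbs u \<inter> nbs w)) + (\<Sum>w\<in>nbs u \<inter> {z}. card (nbs u \<inter> nbs w))"
      by (subst sum.Int_Diff[of _ _ "{z}"]) auto
    also have "(\<Sum>w\<in>nbs u \<inter> {z}. card (nbs u \<inter> nbs w)) \<le> card (nbs u - {z})"
    proof -
      have "card (nbs u \<inter> nbs z) \<le> card (nbs u - {z})" by (rule card_mono) auto
      then show ?thesis by (cases "z \<in> nbs u") simp_all
    qed
    also have "(\<Sum>w\<in>nbs u - {z}. card (nbs u \<inter> nbs w)) \<le> (\<Sum>w\<in>nbs u - {z}. 4)"
    proof (rule sum_mono)
      fix w assume w: "w \<in> nbs u - {z}"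
      have "card (nbs u \<inter> nbs w) \<le> card (nbs u - {w})" by (rule card_mono) auto
      also have "\<dots> \<le> 4" using w deg[of u] u by (auto simp: deg_def)
      finally show "card (nbs u \<inter> nbs w) \<le> 4" .
    qed
    finally show ?thesis by simp
  qed
  have "triangles = (\<Sum>w\<in>nbs z. card (nbs z \<inter> nbs w)) + (\<Sum>u\<in>V-{z}. \<Sum>w\<in>nbs u. card (nbs u \<inter> nbs w))"
    unfolding triangles_def using z by (intro sum.remove) auto
  also have "\<dots> \<le> e + (\<Sum>u\<in>V-{z}. 5 * card (nbs u - {z}))"
    using at_z off_z by (intro add_mono sum_mono) auto
  also have "\<dots> = 6 * e" by (simp add: e_def flip: sum_distrib_left)
  finally have "real triangles \<le> 6 * real e" by linarith
  moreover have "(\<Sum>u\<in>V-{z}. real (deg u)) = real e + real (deg z)"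
    using e by (metis of_nat_add of_nat_sum)
  ultimately show ?thesis by simp
qed

text \<open>Let \<open>d\<close> be the degree of the vertex \<open>z\<close> that may have degree above 5. Elsewhere the third moment
  is at most 5 times the second, and the second at most 5 times the first. If \<open>d < N\<close>, the third
  moment and the bound on triangles give \<open>N\<^sup>2 + Nd + d\<^sup>2 \<le> 29N + 5d + 12\<close> after division by
  \<open>N - d\<close>; the first two moments give \<open>d\<^sup>2 - 5d \<ge> N\<^sup>2 - 11N\<close>. Together \<open>2N\<^sup>2 + Nd \<le> 40N + 12\<close>,
  which for \<open>N \<ge> 20\<close> leaves only \<open>d = 0\<close>, and that contradicts the second inequality. The numbers in the
  hypotheses are the moments of \<open>K\<^sub>1 \<or> (C\<^sub>k \<union> qK\<^sub>2 \<union> sK\<^sub>1)\<close>, which has \<open>k + q\<close> triangles.\<close>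

lemma dominating_vertex:
  fixes N k q s :: nat
  assumes card: "card V = N + 1" and N: "N = k + 2 * q + s" "N \<ge> 20"
    and s1: "(\<Sum>v\<in>V. real (deg v)) = 2 * (N + k + q)"
    and s2: "(\<Sum>v\<in>V. real (deg v)^2) = N\<^sup>2 + 9 * k + 8 * q + s"
    and s3: "(\<Sum>v\<in>V. real (deg v)^3) + real triangles = N^3 + 33 * k + 22 * q + s"
    and deg5: "\<And>u v. u \<in> V \<Longrightarrow> v \<in> V \<Longrightarrow> u \<noteq> v \<Longrightarrow> deg u \<le> 5 \<or> deg v \<le> 5"
  obtains z where "z \<in> V" "deg z = N"
proof -
  have "V \<noteq> {}" using card by auto
  have "\<exists>z\<in>V. \<forall>v\<in>V. v \<noteq> z \<longrightarrow> deg v \<le> 5"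
  proof (cases "\<exists>z\<in>V. deg z \<ge> 6")
    case True
    then show ?thesis using deg5 by force
  next
    case False
    then have "\<forall>v\<in>V. deg v \<le> 5" by auto
    then show ?thesis using \<open>V \<noteq> {}\<close> by blast
  qed
  then obtain z where z: "z \<in> V" and small: "\<And>v. v \<in> V \<Longrightarrow> v \<noteq> z \<Longrightarrow> deg v \<le> 5" by blast
  define d S1 S2 S3 where "d = real (deg z)" and "S1 = (\<Sum>v\<in>V-{z}. real (deg v))"
    and "S2 = (\<Sum>v\<in>V-{z}. real (deg v)^2)" and "S3 = (\<Sum>v\<in>V-{z}. real (deg v)^3)"
  have split: "(\<Sum>v\<in>V. f v) = f z + (\<Sum>v\<in>V-{z}. f v)" for f :: "'a \<Rightarrow> real"
    using z by (simp add: sum.remove)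
  have "real m ^ 2 \<le> 5 * real m" "real m ^ 3 \<le> 5 * real m ^ 2" if "m \<le> 5" for m
  proof -
    have "real m * real m \<le> 5 * real m" "real m * real m ^ 2 \<le> 5 * real m ^ 2"
      using that by (intro mult_right_mono; simp)+
    then show "real m ^ 2 \<le> 5 * real m" "real m ^ 3 \<le> 5 * real m ^ 2"
      by (simp_all add: power2_eq_square power3_eq_cube)
  qed
  then have le21: "S2 \<le> 5 * S1" and le32: "S3 \<le> 5 * S2"
    unfolding S1_def S2_def S3_def sum_distrib_left using small by (auto intro!: sum_mono)
  have t: "real triangles \<le> 6 * (S1 - d)"
    unfolding S1_def d_def by (rule triangles_le[OF z small])
  have e1: "d + S1 = 2 * (N + k + q)" and e2: "d\<^sup>2 + S2 = N\<^sup>2 + 9 * k + 8 * q + s"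
    and e3: "d^3 + S3 + real triangles = N^3 + 33 * k + 22 * q + s"
    using s1 s2 s3 unfolding split by (simp_all add: d_def S1_def S2_def S3_def)
  define n K where "n = real N" and "K = real k"
  have n20: "n \<ge> 20" using N by (simp add: n_def)
  have dn: "deg z \<le> N"
  proof -
    have "deg z \<le> card (V - {z})" unfolding deg_def by (rule card_mono) (use adj_V in auto)
    then show ?thesis using z card by simp
  qed
  show ?thesis
  proof (cases "deg z = N")
    case False
    then have "d \<le> n - 1" using dn by (simp add: d_def n_def)
    have d0: "d \<ge> 0" by (simp add: d_def)
    have N': "n = real k + 2 * real q + real s" using N by (simp add: n_def)
    have A: "d\<^sup>2 - 5 * d \<ge> n\<^sup>2 - 11 * n"
      using le21 e1 e2 N' by (simp add: n_def)
    have "n^3 - d^3 \<le> 5 * (n\<^sup>2 - d\<^sup>2) + 12 * (n - d) + 24 * n"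
      using le32 t e1 e2 e3 N' by (simp add: n_def)
    moreover have "n^3 - d^3 = (n - d) * (n\<^sup>2 + n * d + d\<^sup>2)" "5 * (n\<^sup>2 - d\<^sup>2) = (n - d) * (5 * (n + d))"
      by (simp_all add: power2_eq_square power3_eq_cube algebra_simps)
    moreover have "24 * n \<le> (n - d) * (24 * n)" using \<open>d \<le> n - 1\<close> n20 by simp
    ultimately have "(n - d) * (n\<^sup>2 + n * d + d\<^sup>2) \<le> (n - d) * (5 * (n + d) + 12 + 24 * n)"
      by (simp add: algebra_simps)
    then have B: "n\<^sup>2 + n * d + d\<^sup>2 \<le> 29 * n + 5 * d + 12" using \<open>d \<le> n - 1\<close> by simp
    have C: "20 * n \<le> n\<^sup>2" using n20 by (simp add: power2_eq_square)
    have "n * d \<le> 12" using A B C by simp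
    moreover have "20 * d \<le> n * d" using n20 d0 by (rule mult_right_mono)
    ultimately have "d < 1" by simp
    then have "d = 0" by (simp add: d_def)
    then show ?thesis using A C n20 by simp
  qed (use that z in blast)
qed

end

section \<open>Cones\<close>

text \<open>Graphs \<open>K\<^sub>1 \<or> H\<close>, seen from inside: \<open>z\<close> is the apex, \<open>W\<close> the vertex set of the base \<open>H\<close>, and \<open>nb\<close>
  and \<open>h\<close> are neighbourhood and degree in \<open>H\<close>.\<close>

locale cone = simple_graph +
  fixes z
  assumes z [simp]: "z \<in> V" and apex: "v \<in> V \<Longrightarrow> v \<noteq> z \<Longrightarrow> adj z v"
begin

definition W where "W = V - {z}"
definition nb where "nb v = nbs v - {z}"
definition h where "h v = card (nb v)"

lemma finite_W [simp]: "finite W" and finite_nb [simp]: "finite (nb v)" and z_W [simp]: "z \<notin> W" "z \<notin> nb v"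
  by (auto simp: W_def nb_def)

lemma nb_W: "w \<in> nb v \<Longrightarrow> w \<in> W" using adj_V by (auto simp: nb_def W_def)

lemma mem_nb: "w \<in> nb v \<longleftrightarrow> adj v w \<and> w \<noteq> z" by (auto simp: nb_def)

lemma nb_sym: "v \<in> W \<Longrightarrow> w \<in> nb v \<Longrightarrow> v \<in> nb w"
  using adj_sym by (auto simp: nb_def W_def)

lemma V_eq: "V = insert z W" by (auto simp: W_def)

lemma nbs_z: "nbs z = W" using adj_V by (auto simp: W_def intro: apex)

lemma nbs_W: "v \<in> W \<Longrightarrow> nbs v = insert z (nb v)"
  using apex adj_sym by (auto simp: nb_def W_def)

lemma deg_z: "deg z = card W" by (simp add: deg_def nbs_z)

lemma deg_W: "v \<in> W \<Longrightarrow> deg v = h v + 1" by (simp add: deg_def nbs_W h_def)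

lemma sum_V: "(\<Sum>v\<in>V. f v) = f z + (\<Sum>v\<in>W. f v)" by (simp add: V_eq)

lemma sum_nb_swap: "(\<Sum>u\<in>W. \<Sum>w\<in>nb u. f u w) = (\<Sum>u\<in>W. \<Sum>w\<in>nb u. f w u)"
proof -
  have "(\<Sum>u\<in>W. \<Sum>w\<in>nb u. f u w) = (\<Sum>(u,w)\<in>Sigma W nb. f u w)" for f :: "'a \<Rightarrow> 'a \<Rightarrow> 'b::comm_monoid_add"
    by (rule sum.Sigma) auto
  moreover have "(\<Sum>(u,w)\<in>Sigma W nb. f u w) = (\<Sum>(u,w)\<in>Sigma W nb. f w u)"
    by (rule sum.reindex_bij_witness[of _ prod.swap prod.swap]) (auto intro: nb_sym nb_W)
  ultimately show ?thesis by metis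
qed

definition base_triangles :: nat where
  "base_triangles = (\<Sum>u\<in>W. \<Sum>w\<in>nb u. card (nb u \<inter> nb w))"

lemma triangles_cone: "triangles = 3 * (\<Sum>u\<in>W. h u) + base_triangles"
proof -
  have "(\<Sum>w\<in>nbs u. card (nbs u \<inter> nbs w)) = 2 * h u + (\<Sum>w\<in>nb u. card (nb u \<inter> nb w))" if u: "u \<in> W" for u
  proof -
    have "nbs u \<inter> nbs z = nb u" using u by (auto simp: nbs_W nbs_z nb_W)
    moreover have "nbs u \<inter> nbs w = insert z (nb u \<inter> nb w)" if "w \<in> nb u" for w
      using u nb_W[OF that] by (auto simp: nbs_W)
    ultimately show ?thesis using u by (simp add: nbs_W sum.distrib sum_Suc h_def)
  qed
  moreover have "(\<Sum>w\<in>nbs z. card (nbs z \<inter> nbs w)) = (\<Sum>w\<in>W. h w)"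
    unfolding nbs_z h_def by (intro sum.cong refl arg_cong[of _ _ card]) (auto simp: nbs_W nb_W)
  ultimately show ?thesis
    by (simp add: triangles_def sum_V sum.distrib base_triangles_def flip: sum_distrib_left)
qed

lemma degree_moments:
  shows "(\<Sum>v\<in>V. real (deg v)) = 2 * real (card W) + (\<Sum>v\<in>W. real (h v))"
    and "(\<Sum>v\<in>V. real (deg v)^2)
      = real (card W)^2 + real (card W) + 2 * (\<Sum>v\<in>W. real (h v)) + (\<Sum>v\<in>W. real (h v)^2)"
    and "(\<Sum>v\<in>V. real (deg v)^3) + real triangles
      = real (card W)^3 + real (card W) + 6 * (\<Sum>v\<in>W. real (h v)) + 3 * (\<Sum>v\<in>W. real (h v)^2)
        + (\<Sum>v\<in>W. real (h v)^3) + real base_triangles"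
proof -
  have 2: "(1 + real m)^2 = 1 + 2 * real m + real m ^ 2"
    and 3: "(1 + real m)^3 = 1 + 3 * real m + 3 * real m ^ 2 + real m ^ 3" for m :: nat
    by (simp_all add: power2_eq_square power3_eq_cube algebra_simps)
  show "(\<Sum>v\<in>V. real (deg v)) = 2 * real (card W) + (\<Sum>v\<in>W. real (h v))"
    by (simp add: sum_V deg_z deg_W sum.distrib)
  show "(\<Sum>v\<in>V. real (deg v)^2)
      = real (card W)^2 + real (card W) + 2 * (\<Sum>v\<in>W. real (h v)) + (\<Sum>v\<in>W. real (h v)^2)"
    by (simp add: sum_V deg_z deg_W 2 sum.distrib flip: sum_distrib_left)
  show "(\<Sum>v\<in>V. real (deg v)^3) + real triangles
      = real (card W)^3 + real (card W) + 6 * (\<Sum>v\<in>W. real (h v)) + 3 * (\<Sum>v\<in>W. real (h v)^2)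
        + (\<Sum>v\<in>W. real (h v)^3) + real base_triangles"
    by (simp add: sum_V deg_z deg_W 3 sum.distrib triangles_cone flip: sum_distrib_left)
qed

lemma sum_over_h:
  fixes f :: "nat \<Rightarrow> real"
  assumes le: "\<And>v. v \<in> W \<Longrightarrow> h v \<le> 2"
  shows "(\<Sum>v\<in>W. f (h v)) = real (card {v \<in> W. h v = 2}) * f 2
    + real (card {v \<in> W. h v = 1}) * f 1 + real (card {v \<in> W. h v = 0}) * f 0"
proof -
  have "f (h v) = (if h v = 2 then f 2 else 0) + (if h v = 1 then f 1 else 0) + (if h v = 0 then f 0 else 0)"
    if "v \<in> W" for v
  proof -
    have "h v = 0 \<or> h v = 1 \<or> h v = 2" using le[OF that] by linarith
    then show ?thesis by (elim disjE) simp_all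
  qed
  then have "(\<Sum>v\<in>W. f (h v)) = (\<Sum>v\<in>W. if h v = 2 then f 2 else 0) + (\<Sum>v\<in>W. if h v = 1 then f 1 else 0)
      + (\<Sum>v\<in>W. if h v = 0 then f 0 else 0)"
    by (simp add: sum.distrib)
  then show ?thesis by (simp flip: sum.inter_filter)
qed

text \<open>The eigenvalue equation, row by row. The apex adds 1 to the degree of each base vertex, whence
  the shift by 1.\<close>

lemma eigenfun_cone:
  "eigenfun \<mu> x \<longleftrightarrow> (\<exists>v\<in>V. x v \<noteq> 0) \<and> (\<mu> - card W) * x z = (\<Sum>v\<in>W. x v) \<and>
    (\<forall>v\<in>W. (\<mu> - 1 - h v) * x v = x z + (\<Sum>w\<in>nb v. x w))"
proof -
  have "(\<forall>v\<in>V. (\<Sum>w\<in>V. Q v w * x w) = \<mu> * x v) \<longleftrightarrow>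
     (\<forall>v\<in>V. real (deg v) * x v + (\<Sum>w\<in>nbs v. x w) = \<mu> * x v)"
    by (auto simp: Q_apply)
  also have "\<dots> \<longleftrightarrow> (real (card W) * x z + (\<Sum>w\<in>W. x w) = \<mu> * x z) \<and>
     (\<forall>v\<in>W. real (h v + 1) * x v + (x z + (\<Sum>w\<in>nb v. x w)) = \<mu> * x v)"
    by (auto simp: V_eq deg_z deg_W nbs_z nbs_W)
  also have "\<dots> \<longleftrightarrow> (\<mu> - card W) * x z = (\<Sum>v\<in>W. x v) \<and>
    (\<forall>v\<in>W. (\<mu> - 1 - h v) * x v = x z + (\<Sum>w\<in>nb v. x w))"
    by (auto simp: algebra_simps)
  finally show ?thesis by (simp add: eigenfun_def)
qed

text \<open>A maximum principle: at a vertex of \<open>S\<close> where \<open>\<bar>x\<bar>\<close> is largest, the right side is a sum of \<open>h v\<close>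
  terms of modulus at most \<open>\<bar>x v\<bar>\<close>, while \<open>a v > h v\<close>.\<close>

lemma diagonally_dominant_zero:
  fixes x a :: "'a \<Rightarrow> real"
  assumes S: "finite S" "\<And>v. v \<in> S \<Longrightarrow> nb v \<subseteq> S" and a: "\<And>v. v \<in> S \<Longrightarrow> a v > h v"
    and eq: "\<And>v. v \<in> S \<Longrightarrow> a v * x v = (\<Sum>w\<in>nb v. x w)" and v: "v \<in> S"
  shows "x v = 0"
proof -
  have fin: "finite ((\<lambda>v. \<bar>x v\<bar>) ` S)" "(\<lambda>v. \<bar>x v\<bar>) ` S \<noteq> {}" using S v by auto
  define M where "M = Max ((\<lambda>v. \<bar>x v\<bar>) ` S)"
  have "M \<in> (\<lambda>v. \<bar>x v\<bar>) ` S" unfolding M_def by (rule Max_in[OF fin])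
  then obtain u where u: "u \<in> S" "\<bar>x u\<bar> = M" by auto
  have le: "\<bar>x w\<bar> \<le> M" if "w \<in> S" for w
    unfolding M_def by (rule Max_ge[OF fin(1)]) (use that in blast)
  have "0 \<le> a u" using a[OF u(1)] by simp
  then have "a u * M = \<bar>a u * x u\<bar>" by (simp add: abs_mult u(2))
  also have "\<dots> \<le> (\<Sum>w\<in>nb u. \<bar>x w\<bar>)" unfolding eq[OF u(1)] by (rule sum_abs)
  also have "\<dots> \<le> (\<Sum>w\<in>nb u. M)" using S(2)[OF u(1)] le by (intro sum_mono) auto
  finally have "(a u - h u) * M \<le> 0" by (simp add: h_def algebra_simps)
  then have "M \<le> 0" using a[OF u(1)] by (simp add: mult_le_0_iff)
  then show ?thesis using le[OF v] by simp
qed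

end

section \<open>The secular equation\<close>

text \<open>The apex row of the eigenvalue equation after elimination of the base: if neighbours in the base
  have equal degree \<open>h\<close>, the base coordinates of an eigenvector with apex coordinate 1 are
  \<open>1/(t - 1 - 2h)\<close>.\<close>

definition secular :: "nat \<Rightarrow> nat \<Rightarrow> nat \<Rightarrow> real \<Rightarrow> real" where
  "secular k q s t = t - (k + 2 * q + s) - (k / (t - 5) + 2 * real q / (t - 3) + s / (t - 1))"

lemma secular_strict_mono:
  assumes "5 < t" "t < u"
  shows "secular k q s t < secular k q s u"
proof -
  have "real k / (u - 5) \<le> k / (t - 5)" "2 * real q / (u - 3) \<le> 2 * real q / (t - 3)" "real s / (u - 1) \<le> s / (t - 1)"
    using assms by (auto intro!: divide_left_mono)
  then show ?thesis using assms by (simp add: secular_def)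
qed

text \<open>By the intermediate value theorem on \<open>[N, 2N]\<close>, where \<open>N = k + 2q + s\<close>: the fractions have a
  positive sum at \<open>N\<close>, and at \<open>2N\<close> the denominators are at least 5, so that the fractions sum to at most \<open>N\<close>.\<close>

lemma secular_root_exists:
  assumes "k + 2 * q + s > 5"
  obtains \<mu> where "\<mu> > real (k + 2 * q + s)" "secular k q s \<mu> = 0"
proof -
  define N where "N = real (k + 2 * q + s)"
  have N: "N > 5" using assms by (simp add: N_def)
  have at_N: "secular k q s N \<le> 0"
  proof -
    have "real k / (N - 5) + 2 * real q / (N - 3) + s / (N - 1) \<ge> 0" using N by (intro add_nonneg_nonneg) auto
    then show ?thesis by (simp add: secular_def N_def)
  qed
  have at_2N: "secular k q s (2 * N) \<ge> 0"
  proof -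
    have "real k / (2 * N - 5) \<le> k / 5" "2 * real q / (2 * N - 3) \<le> 2 * real q / 5" "real s / (2 * N - 1) \<le> s / 5"
      by (rule divide_left_mono; use N in simp)+
    moreover have "N = real k + 2 * real q + real s" by (simp add: N_def)
    ultimately show ?thesis unfolding secular_def N_def[symmetric] using N by linarith
  qed
  have "continuous_on {N..2*N} (secular k q s)"
    unfolding secular_def using N by (intro continuous_intros) auto
  then obtain \<mu> where \<mu>: "N \<le> \<mu>" "\<mu> \<le> 2 * N" "secular k q s \<mu> = 0"
    using IVT'[of "secular k q s" N 0 "2 * N", OF at_N at_2N] N by auto
  have "\<mu> \<noteq> N"
  proof
    assume "\<mu> = N"
    have "k > 0 \<or> q > 0 \<or> s > 0" using assms by auto
    then have "real k / (N - 5) > 0 \<or> 2 * real q / (N - 3) > 0 \<or> real s / (N - 1) > 0" using N by auto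
    moreover have "real k / (N - 5) \<ge> 0" "2 * real q / (N - 3) \<ge> 0" "real s / (N - 1) \<ge> 0" using N by auto
    ultimately have "real k / (N - 5) + 2 * real q / (N - 3) + s / (N - 1) > 0" by linarith
    then show False using \<mu>(3) \<open>\<mu> = N\<close> by (simp add: secular_def N_def)
  qed
  then show ?thesis using that[of \<mu>] \<mu> by (simp add: N_def)
qed

text \<open>The base is known up to the way in which its paths and cycles are cut: this much follows from
  the moments.\<close>

locale cone_over_low_degree = cone +
  fixes k q s :: nat
  assumes h_le_2: "v \<in> W \<Longrightarrow> h v \<le> 2"
    and card_2: "card {v \<in> W. h v = 2} = k"
    and card_1: "card {v \<in> W. h v = 1} = 2 * q"
    and card_0: "card {v \<in> W. h v = 0} = s"
begin

definition R where "R = {v \<in> W. h v = 2}"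

lemma sum_by_h: "(\<Sum>v\<in>W. f (h v)) = real k * f 2 + 2 * real q * f 1 + real s * f 0"
  using sum_over_h[OF h_le_2, of f] by (simp add: card_2 card_1 card_0 del: One_nat_def)

lemma card_W: "card W = k + 2 * q + s"
proof -
  have "real (card W) = real (k + 2 * q + s)" using sum_by_h[of "\<lambda>_. 1"] by simp
  then show ?thesis by linarith
qed

lemma secular_sum: "(\<Sum>v\<in>W. 1 / (t - 1 - 2 * real (h v))) = k / (t - 5) + 2 * real q / (t - 3) + s / (t - 1)"
  by (subst sum_by_h[of "\<lambda>m. 1 / (t - 1 - 2 * real m)"]) simp

text \<open>Scale the eigenvector to be 1 at the apex, and let \<open>u\<close> be its restriction to the base; then
  \<open>u\<close> is positive. Let \<open>c v = 1/(\<mu> - 1 - 2h v)\<close>, which would be \<open>u\<close> if neighbours had equal degree.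
  The apex row says that \<open>u\<close> sums to \<open>\<mu> - \<bar>W\<bar>\<close>, and the secular equation says the same of \<open>c\<close>.
  Pairing the equation of each of the two with the other function turns this equality into
  \<open>\<Sum> (c v - c w)(u v - u w) = 0\<close>, the sum being over adjacent \<open>v, w\<close>. On an edge from a vertex of
  degree 2 to a leaf both \<open>c\<close> and \<open>u\<close> are larger at the former, and on all other edges \<open>c v = c w\<close>.
  So no term is negative, and an edge between different degrees would make the sum positive. In
  other words, for given degrees in the base, paths with more than one edge lower the spectral radius.\<close>

lemma same_degree_of_secular:
  assumes x: "eigenfun \<mu> x" and \<mu>: "\<mu> > 5" and sec: "secular k q s \<mu> = 0"
    and vw: "v \<in> W" "w \<in> nb v"
  shows "h w = h v"
proof -
  have eq: "(\<mu> - 1 - h v) * x v = x z + (\<Sum>w\<in>nb v. x w)" if "v \<in> W" for v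
    using x that by (auto simp: eigenfun_cone)
  have hub: "(\<mu> - card W) * x z = (\<Sum>v\<in>W. x v)" using x by (simp add: eigenfun_cone)
  have hle: "\<mu> - 1 - 2 * real (h v) > 0" if "v \<in> W" for v using h_le_2[OF that] \<mu> by auto
  \<comment> \<open>an eigenvector that vanishes at the apex is one of the base, where eigenvalues are at most 5\<close>
  have xz: "x z \<noteq> 0"
  proof
    assume xz: "x z = 0"
    have "x v = 0" if "v \<in> W" for v
    proof (rule diagonally_dominant_zero[where S = W and a = "\<lambda>v. \<mu> - 1 - h v"])
      show "real (h v) < \<mu> - 1 - real (h v)" if "v \<in> W" for v using hle[OF that] by simp
    qed (use that eq xz nb_W in auto)
    then show False using x xz by (auto simp: eigenfun_cone V_eq)
  qed
  define u where "u v = x v / x z" for v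
  have u_eq: "(\<mu> - 1 - h v) * u v = 1 + (\<Sum>w\<in>nb v. u w)" if "v \<in> W" for v
    using eq[OF that] xz by (simp add: u_def field_simps flip: sum_divide_distrib)
  \<comment> \<open>the equation at a vertex where \<open>u\<close> is smallest\<close>
  have u_pos: "u v > 0" if v: "v \<in> W" for v
  proof -
    have fin: "finite (u ` W)" "u ` W \<noteq> {}" using v by auto
    define m where "m = Min (u ` W)"
    have "m \<in> u ` W" unfolding m_def by (rule Min_in[OF fin])
    then obtain a where a: "a \<in> W" "u a = m" by auto
    have le: "m \<le> u w" if "w \<in> W" for w unfolding m_def by (rule Min_le[OF fin(1)]) (use that in blast)
    have "(\<Sum>w\<in>nb a. m) \<le> (\<Sum>w\<in>nb a. u w)" using le nb_W by (intro sum_mono) auto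
    then have "1 + real (h a) * m \<le> (\<mu> - 1 - h a) * m" using u_eq[OF a(1)] a(2) by (simp add: h_def)
    then have "0 < (\<mu> - 1 - 2 * real (h a)) * m" by (simp add: algebra_simps)
    then have "m > 0" using hle[OF a(1)] by (simp add: zero_less_mult_iff)
    then show ?thesis using le[OF v] by simp
  qed
  define c where "c v = 1 / (\<mu> - 1 - 2 * real (h v))" for v
  have c_eq: "(\<mu> - 1 - h v) * c v = 1 + real (h v) * c v" if "v \<in> W" for v
    using hle[OF that] by (simp add: c_def field_simps)
  have "(\<Sum>v\<in>W. u v) = \<mu> - card W"
    using hub xz by (simp add: u_def nonzero_divide_eq_eq flip: sum_divide_distrib)
  also have "\<dots> = (\<Sum>v\<in>W. c v)"
    using sec unfolding c_def secular_sum by (simp add: secular_def card_W)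
  finally have sums: "(\<Sum>v\<in>W. u v) = (\<Sum>v\<in>W. c v)" .
  \<comment> \<open>pair the equation for \<open>u\<close> with \<open>c\<close> and that for \<open>c\<close> with \<open>u\<close>\<close>
  have "(\<Sum>v\<in>W. c v * ((\<mu> - 1 - h v) * u v)) = (\<Sum>v\<in>W. c v) + (\<Sum>v\<in>W. \<Sum>w\<in>nb v. c v * u w)"
  proof -
    have "c v * ((\<mu> - 1 - h v) * u v) = c v + (\<Sum>w\<in>nb v. c v * u w)" if "v \<in> W" for v
      unfolding u_eq[OF that] by (simp add: distrib_left sum_distrib_left)
    then show ?thesis by (simp add: sum.distrib)
  qed
  moreover have "(\<Sum>v\<in>W. c v * ((\<mu> - 1 - h v) * u v)) = (\<Sum>v\<in>W. u v) + (\<Sum>v\<in>W. \<Sum>w\<in>nb v. c v * u v)"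
  proof -
    have "c v * ((\<mu> - 1 - h v) * u v) = u v + (\<Sum>w\<in>nb v. c v * u v)" if "v \<in> W" for v
    proof -
      have "c v * ((\<mu> - 1 - h v) * u v) = ((\<mu> - 1 - h v) * c v) * u v" by simp
      also have "\<dots> = u v + (\<Sum>w\<in>nb v. c v * u v)"
        unfolding c_eq[OF that] by (simp add: h_def algebra_simps)
      finally show ?thesis .
    qed
    then show ?thesis by (simp add: sum.distrib)
  qed
  ultimately have bal: "(\<Sum>v\<in>W. \<Sum>w\<in>nb v. c v * u w) = (\<Sum>v\<in>W. \<Sum>w\<in>nb v. c v * u v)"
    using sums by simp
  have "(\<Sum>v\<in>W. \<Sum>w\<in>nb v. (c v - c w) * (u v - u w))
      = ((\<Sum>v\<in>W. \<Sum>w\<in>nb v. c v * u v) - (\<Sum>v\<in>W. \<Sum>w\<in>nb v. c v * u w))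
      + ((\<Sum>v\<in>W. \<Sum>w\<in>nb v. c w * u w) - (\<Sum>v\<in>W. \<Sum>w\<in>nb v. c w * u v))"
    by (simp add: algebra_simps sum.distrib sum_subtractf)
  also have "\<dots> = 0"
    using bal sum_nb_swap[of "\<lambda>v w. c w * u w"] sum_nb_swap[of "\<lambda>v w. c w * u v"] by simp
  finally have zero: "(\<Sum>v\<in>W. \<Sum>w\<in>nb v. (c v - c w) * (u v - u w)) = 0" .
  have mixed: "c w < c v \<and> u w < u v" if "v \<in> W" "w \<in> nb v" "h w < h v" for v w
  proof
    have w: "w \<in> W" "v \<in> nb w" using nb_W[OF that(2)] nb_sym[OF that(1,2)] .
    have "h w > 0" using w by (auto simp: h_def card_gt_0_iff)
    then have hh: "h w = 1" "h v = 2" using that h_le_2[OF that(1)] by auto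
    show "c w < c v" using hle[OF that(1)] hle[OF w(1)] by (simp add: c_def hh frac_less2)
    have "nb w = {v}" using hh(1) w(2) unfolding h_def by (auto simp: card_1_singleton_iff)
    then have "(\<mu> - 2) * u w = 1 + u v" using u_eq[OF w(1)] hh by simp
    moreover have "u w \<le> (\<Sum>w\<in>nb v. u w)"
      using that(2) less_imp_le[OF u_pos[OF nb_W]] by (intro member_le_sum) auto
    then have "1 + u w \<le> (\<mu> - 3) * u v" using u_eq[OF that(1)] hh by simp
    ultimately have "(\<mu> - 1) * (u v - u w) \<ge> u v" by (simp add: algebra_simps)
    then have "(\<mu> - 1) * (u v - u w) > 0" using u_pos[OF that(1)] by linarith
    then show "u w < u v" using \<mu> by (simp add: zero_less_mult_iff)
  qed
  have nonneg: "(c v - c w) * (u v - u w) \<ge> 0" if "v \<in> W" "w \<in> nb v" for v w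
  proof -
    consider "h v = h w" | "h w < h v" | "h v < h w" by linarith
    then show ?thesis
    proof cases
      case 1
      then show ?thesis by (simp add: c_def)
    next
      case 2
      then show ?thesis using mixed[OF that] by simp
    next
      case 3
      then show ?thesis using mixed[OF nb_W[OF that(2)] nb_sym[OF that]] by (simp add: mult_nonpos_nonpos)
    qed
  qed
  have "(c v - c w) * (u v - u w) = 0"
  proof -
    have "\<forall>v\<in>W. (\<Sum>w\<in>nb v. (c v - c w) * (u v - u w)) = 0"
      by (rule iffD1[OF sum_nonneg_eq_0_iff zero]) (use nonneg in \<open>auto intro!: sum_nonneg\<close>)
    then have zero_v: "(\<Sum>w\<in>nb v. (c v - c w) * (u v - u w)) = 0" using vw(1) by blast
    have "\<forall>w\<in>nb v. (c v - c w) * (u v - u w) = 0"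
      by (rule iffD1[OF sum_nonneg_eq_0_iff zero_v]) (use nonneg[OF vw(1)] in auto)
    then show ?thesis using vw(2) by blast
  qed
  then have "c v = c w \<or> u v = u w" by simp
  then have "\<not> h w < h v" "\<not> h v < h w"
    using mixed[OF vw] mixed[OF nb_W[OF vw(2)] nb_sym[OF vw]] by auto
  then show ?thesis by simp
qed

text \<open>If \<open>A\<close> were a proper part, give its vertices the value \<open>\<bar>R - A\<bar>\<close> and the other vertices of degree
  2 the value \<open>- \<bar>A\<bar>\<close>. The values sum to 0, which is the apex row, and are constant along edges of
  the base, so that this is an eigenvector for \<open>1 + 2 \<cdot> 2\<close>.\<close>

lemma rim_connected:
  assumes same: "\<And>v w. v \<in> W \<Longrightarrow> w \<in> nb v \<Longrightarrow> h w = h v" and five: "\<not> (\<exists>x. eigenfun 5 x)"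
    and A: "A \<subseteq> R" "A \<noteq> {}" "\<And>v. v \<in> A \<Longrightarrow> nb v \<subseteq> A"
  shows "A = R"
proof (rule ccontr)
  assume "A \<noteq> R"
  have "finite R" by (simp add: R_def)
  then have fin: "finite R" "finite A" using finite_subset[OF A(1)] by auto
  define B where "B = R - A"
  have B: "B \<noteq> {}" "finite B" "A \<inter> B = {}" "R = A \<union> B" using A fin \<open>A \<noteq> R\<close> by (auto simp: B_def)
  have AW: "A \<subseteq> W" "B \<subseteq> W" using A by (auto simp: R_def B_def)
  have nbB: "nb v \<subseteq> B" if "v \<in> B" for v
  proof
    fix w assume w: "w \<in> nb v"
    have v: "v \<in> W" "h v = 2" "v \<notin> A" using that by (auto simp: B_def R_def)
    have "w \<in> R" using same[OF v(1) w] v nb_W[OF w] by (simp add: R_def)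
    moreover have "w \<notin> A" using A(3)[of w] nb_sym[OF v(1) w] v by auto
    ultimately show "w \<in> B" by (simp add: B_def)
  qed
  define x where "x v = (if v \<in> A then real (card B) else if v \<in> B then - real (card A) else 0)" for v
  have hA: "v \<in> A \<or> v \<in> B \<Longrightarrow> h v = 2" for v using A by (auto simp: B_def R_def)
  have xz: "x z = 0" using AW by (auto simp: x_def)
  have "(\<Sum>v\<in>W. x v) = (\<Sum>v\<in>A \<union> B. x v)"
    by (rule sum.mono_neutral_right) (use AW in \<open>auto simp: x_def\<close>)
  also have "\<dots> = (\<Sum>v\<in>A. x v) + (\<Sum>v\<in>B. x v)" using fin B by (intro sum.union_disjoint) auto
  also have "(\<Sum>v\<in>A. x v) = (\<Sum>v\<in>A. real (card B))" by (rule sum.cong) (auto simp: x_def)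
  also have "(\<Sum>v\<in>B. x v) = (\<Sum>v\<in>B. - real (card A))" using B by (intro sum.cong) (auto simp: x_def)
  finally have sum0: "(\<Sum>v\<in>W. x v) = 0" by simp
  have eq: "(4 - real (h v)) * x v = (\<Sum>w\<in>nb v. x w)" if v: "v \<in> W" for v
  proof -
    have "x w = x v" if "w \<in> nb v" for w
    proof -
      have "w \<in> A \<longleftrightarrow> v \<in> A" "w \<in> B \<longleftrightarrow> v \<in> B"
        using that A(3) nbB nb_sym[OF v that] by blast+
      then show ?thesis by (simp add: x_def)
    qed
    then have "(\<Sum>w\<in>nb v. x w) = real (h v) * x v" by (simp add: h_def)
    moreover have "x v = 0 \<or> h v = 2" using hA by (auto simp: x_def)
    ultimately show ?thesis by auto
  qed
  obtain a where "a \<in> A" using A by blast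
  then have "x a \<noteq> 0" "a \<in> V" using B fin AW by (auto simp: x_def V_eq)
  then have "eigenfun 5 x" unfolding eigenfun_cone using xz sum0 eq by auto
  then show False using five by blast
qed

end

section \<open>The spectrum of the cone over a cycle, edges and points\<close>

text \<open>Connectedness of the part \<open>R\<close> of degree 2 is stated as the absence of proper nonempty subsets that
  are closed under taking neighbours, which is the form that the maximum principle needs.\<close>

locale cone_over_cycle_and_edges = cone_over_low_degree +
  assumes k4: "k \<ge> 4"
    and same_h: "v \<in> W \<Longrightarrow> w \<in> nb v \<Longrightarrow> h w = h v"
    and connected: "A \<subseteq> R \<Longrightarrow> A \<noteq> {} \<Longrightarrow> (\<And>v. v \<in> A \<Longrightarrow> nb v \<subseteq> A) \<Longrightarrow> A = R"
begin

lemma nb_R: "v \<in> R \<Longrightarrow> nb v \<subseteq> R"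
  using same_h nb_W by (auto simp: R_def)

lemma finite_R [simp]: "finite R" and card_R: "card R = k"
  using card_2 by (auto simp: R_def)

text \<open>The difference between the base part of \<open>x\<close> and \<open>x z \<cdot> c\<close>, where \<open>c\<close> is the solution that
  depends on the degree only, satisfies a diagonally dominant homogeneous system.\<close>

lemma eigenfun_large_secular:
  assumes x: "eigenfun \<theta> x" and "\<theta> > 5"
  shows "secular k q s \<theta> = 0"
proof -
  have hle: "\<theta> - 1 - 2 * real (h v) > 0" if "v \<in> W" for v using h_le_2[OF that] assms by auto
  define c where "c v = 1 / (\<theta> - 1 - 2 * real (h v))" for v
  have c_eq: "(\<theta> - 1 - h v) * c v = 1 + real (h v) * c v" if "v \<in> W" for v
    using hle[OF that] by (simp add: c_def field_simps)
  have c_nb: "(\<Sum>w\<in>nb v. c w) = real (h v) * c v" if "v \<in> W" for v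
  proof -
    have "(\<Sum>w\<in>nb v. c w) = (\<Sum>w\<in>nb v. c v)" using same_h[OF that] by (intro sum.cong) (auto simp: c_def)
    then show ?thesis by (simp add: h_def)
  qed
  have xc: "x v = x z * c v" if "v \<in> W" for v
  proof -
    have "x v - x z * c v = 0"
    proof (rule diagonally_dominant_zero[where S = W and a = "\<lambda>v. \<theta> - 1 - h v" and x = "\<lambda>v. x v - x z * c v"])
      show "real (h v) < \<theta> - 1 - real (h v)" if "v \<in> W" for v using hle[OF that] by simp
      show "(\<theta> - 1 - h v) * (x v - x z * c v) = (\<Sum>w\<in>nb v. x w - x z * c w)" if v: "v \<in> W" for v
      proof -
        have "(\<theta> - 1 - h v) * (x v - x z * c v) = (\<theta> - 1 - h v) * x v - x z * ((\<theta> - 1 - h v) * c v)"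
          by (simp add: algebra_simps)
        also have "(\<theta> - 1 - h v) * x v = x z + (\<Sum>w\<in>nb v. x w)" using x v by (simp add: eigenfun_cone)
        also have "x z * ((\<theta> - 1 - h v) * c v) = x z + x z * (\<Sum>w\<in>nb v. c w)"
          unfolding c_eq[OF v] c_nb[OF v] by (simp add: algebra_simps)
        finally show ?thesis by (simp add: sum_subtractf sum_distrib_left)
      qed
    qed (use that nb_W in auto)
    then show ?thesis by simp
  qed
  have xz: "x z \<noteq> 0" using x xc by (auto simp: eigenfun_cone V_eq)
  have "(\<theta> - card W) * x z = (\<Sum>v\<in>W. x v)" using x by (simp add: eigenfun_cone)
  also have "\<dots> = (\<Sum>v\<in>W. c v) * x z" by (simp add: xc sum_distrib_left mult.commute)
  finally have "\<theta> - card W = (\<Sum>v\<in>W. c v)" using xz by simp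
  then show ?thesis unfolding c_def secular_sum by (simp add: secular_def card_W)
qed

lemma secular_eigenfun:
  assumes \<mu>: "\<mu> > 5" and sec: "secular k q s \<mu> = 0"
  shows "\<exists>x. eigenfun \<mu> x"
proof -
  have hle: "\<mu> - 1 - 2 * real (h v) > 0" if "v \<in> W" for v using h_le_2[OF that] \<mu> by auto
  define x where "x v = (if v = z then 1 else 1 / (\<mu> - 1 - 2 * real (h v)))" for v
  have "(\<Sum>v\<in>W. x v) = (\<Sum>v\<in>W. 1 / (\<mu> - 1 - 2 * real (h v)))" by (intro sum.cong) (auto simp: x_def)
  then have "(\<Sum>v\<in>W. x v) = \<mu> - card W" using sec by (simp add: secular_sum secular_def card_W)
  then have "(\<mu> - card W) * x z = (\<Sum>v\<in>W. x v)" by (simp add: x_def)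
  moreover have "\<exists>v\<in>V. x v \<noteq> 0" by (rule bexI[of _ z]) (simp_all add: x_def)
  moreover have "(\<mu> - 1 - h v) * x v = x z + (\<Sum>w\<in>nb v. x w)" if v: "v \<in> W" for v
  proof -
    have "v \<noteq> z" using v by auto
    then have "x w = x v" if "w \<in> nb v" for w
      using that same_h[OF v that] by (auto simp: x_def)
    then have "(\<Sum>w\<in>nb v. x w) = (\<Sum>w\<in>nb v. x v)" by (intro sum.cong) auto
    also have "\<dots> = real (h v) * x v" by (simp add: h_def)
    finally show ?thesis using hle[OF v] v by (auto simp: x_def field_simps)
  qed
  ultimately have "eigenfun \<mu> x" unfolding eigenfun_cone by blast
  then show ?thesis by blast
qed

text \<open>Summing the rows of the cycle cancels everything but \<open>k \<cdot> x z\<close>, so \<open>x\<close> vanishes at the apex. Outside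
  the cycle the base rows are then diagonally dominant, so \<open>x\<close> vanishes there as well. On the cycle
  the vertices where \<open>x\<close> is largest are closed under neighbours, so \<open>x\<close> is constant, and the apex
  row makes the constant 0.\<close>

lemma not_eigenvalue_5: "\<not> eigenfun 5 x"
proof
  assume x: "eigenfun 5 x"
  then have eq: "(4 - real (h v)) * x v = x z + (\<Sum>w\<in>nb v. x w)" if "v \<in> W" for v
    using that by (auto simp: eigenfun_cone)
  have RW: "R \<subseteq> W" by (auto simp: R_def)
  have "(\<Sum>v\<in>R. \<Sum>w\<in>nb v. x w) = (\<Sum>v\<in>W. \<Sum>w\<in>nb v. if v \<in> R then x w else 0)"
    using RW by (intro sum.mono_neutral_cong_left) auto
  also have "\<dots> = (\<Sum>v\<in>W. \<Sum>w\<in>nb v. if w \<in> R then x v else 0)" by (rule sum_nb_swap)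
  also have "\<dots> = (\<Sum>v\<in>R. \<Sum>w\<in>nb v. x v)"
  proof -
    have "(\<Sum>w\<in>nb v. if w \<in> R then x v else 0) = (\<Sum>w\<in>nb v. if v \<in> R then x v else 0)"
      if v: "v \<in> W" for v
      by (rule sum.cong) (use same_h[OF v] nb_W v in \<open>auto simp: R_def\<close>)
    then have "(\<Sum>v\<in>W. \<Sum>w\<in>nb v. if w \<in> R then x v else 0) = (\<Sum>v\<in>W. \<Sum>w\<in>nb v. if v \<in> R then x v else 0)"
      by (rule sum.cong[OF refl])
    also have "\<dots> = (\<Sum>v\<in>R. \<Sum>w\<in>nb v. x v)"
      by (rule sum.mono_neutral_cong_right) (use RW in auto)
    finally show ?thesis .
  qed
  also have "\<dots> = (\<Sum>v\<in>R. 2 * x v)" by (intro sum.cong) (auto simp: R_def h_def)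
  finally have "(\<Sum>v\<in>R. \<Sum>w\<in>nb v. x w) = (\<Sum>v\<in>R. 2 * x v)" .
  moreover have "(\<Sum>v\<in>R. 2 * x v) = (\<Sum>v\<in>R. x z + (\<Sum>w\<in>nb v. x w))"
    using eq by (intro sum.cong) (force simp: R_def)+
  ultimately have xz: "x z = 0" using k4 card_R by (simp add: sum.distrib)
  have rest: "x v = 0" if "v \<in> W - R" for v
  proof (rule diagonally_dominant_zero[where S = "W - R" and a = "\<lambda>v. 4 - real (h v)"])
    show "real (h v) < 4 - real (h v)" if "v \<in> W - R" for v
    proof -
      have "h v \<le> 1" using that h_le_2[of v] by (auto simp: R_def)
      then show ?thesis by simp
    qed
    show "nb v \<subseteq> W - R" if "v \<in> W - R" for v
      using that same_h[of v] nb_W by (auto simp: R_def)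
  qed (use that eq xz in auto)
  have "R \<noteq> {}" using card_R k4 by auto
  then have fin: "finite (x ` R)" "x ` R \<noteq> {}" by auto
  define M where "M = Max (x ` R)"
  have le: "x v \<le> M" if "v \<in> R" for v unfolding M_def by (rule Max_ge[OF fin(1)]) (use that in blast)
  have "{v \<in> R. x v = M} = R"
  proof (rule connected)
    have "M \<in> x ` R" unfolding M_def by (rule Max_in[OF fin])
    then show "{v \<in> R. x v = M} \<noteq> {}" by auto
    show "nb v \<subseteq> {v \<in> R. x v = M}" if v: "v \<in> {v \<in> R. x v = M}" for v
    proof -
      have hv: "card (nb v) = 2" "v \<in> W" using v by (auto simp: R_def h_def)
      have "(\<Sum>w\<in>nb v. M - x w) = 2 * M - (\<Sum>w\<in>nb v. x w)" using hv by (simp add: sum_subtractf)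
      also have "\<dots> = 0" using eq[OF hv(2)] hv xz v by (simp add: h_def)
      finally have "\<forall>w\<in>nb v. M - x w = 0"
        using nb_R v le by (subst (asm) sum_nonneg_eq_0_iff) auto
      then show ?thesis using nb_R v by auto
    qed
  qed auto
  then have const: "x v = M" if "v \<in> R" for v using that by blast
  have "(\<Sum>v\<in>W. x v) = (\<Sum>v\<in>R. x v)" using RW rest by (intro sum.mono_neutral_right) auto
  also have "\<dots> = k * M" using const card_R by simp
  finally have "M = 0" using x xz k4 by (simp add: eigenfun_cone)
  then have "x v = 0" if "v \<in> W" for v using const rest that by blast
  then show False using x xz by (auto simp: eigenfun_cone V_eq)
qed

lemma eigenvalue_ge_5:
  assumes x: "eigenfun \<theta> x" and "\<theta> \<ge> 5" and \<mu>: "\<mu> > 5" "secular k q s \<mu> = 0"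
  shows "\<theta> = \<mu>"
proof -
  have "\<theta> > 5" using assms(2) x not_eigenvalue_5[of x] by (cases "\<theta> = 5") auto
  then have "secular k q s \<theta> = 0" by (rule eigenfun_large_secular[OF x])
  then show ?thesis
    using secular_strict_mono[of \<theta> \<mu> k q s] secular_strict_mono[of \<mu> \<theta> k q s] \<mu> \<open>\<theta> > 5\<close> by linarith
qed

text \<open>A triangle in the base would be all of \<open>R\<close>, by connectedness, but \<open>R\<close> has \<open>k \<ge> 4\<close> vertices.\<close>

lemma base_triangles_eq_0: "base_triangles = 0"
proof -
  have "nb u \<inter> nb w = {}" if u: "u \<in> W" and w: "w \<in> nb u" for u w
  proof (rule ccontr)
    assume "nb u \<inter> nb w \<noteq> {}"
    then obtain t where t: "t \<in> nb u" "t \<in> nb w" by blast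
    have W: "w \<in> W" "t \<in> W" using w t nb_W by auto
    have ne: "u \<noteq> w" "u \<noteq> t" "w \<noteq> t" using w t by (auto simp: mem_nb)
    have in_nb: "u \<in> nb w" "u \<in> nb t" "w \<in> nb t" using nb_sym u w t W by auto
    have two: "nb a = {b, c}" if "a \<in> W" "b \<in> nb a" "c \<in> nb a" "b \<noteq> c" for a b c
    proof (rule card_seteq[symmetric])
      show "card (nb a) \<le> card {b, c}" using h_le_2[OF that(1)] that(4) by (simp add: h_def)
    qed (use that in auto)
    have nbs: "nb u = {w, t}" "nb w = {u, t}" "nb t = {u, w}" using two u W ne in_nb w t by blast+
    have "{u, w, t} = R"
      using nbs u W ne by (intro connected) (auto simp: R_def h_def)
    then have "card R = 3" using ne by (metis card_3_iff)
    then show False using card_R k4 by simp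
  qed
  then show ?thesis by (simp add: base_triangles_def)
qed

end

section \<open>Reconstructing the graph\<close>

text \<open>Induction on \<open>q\<close>, removing one pair \<open>{a, \<pi> a}\<close>; the pairs become the copies of \<open>K\<^sub>2\<close>.
  On second components, \<open>1 - _\<close> exchanges 0 and 1.\<close>

lemma pairing_enumeration:
  assumes "finite L" "\<And>v. v \<in> L \<Longrightarrow> \<pi> v \<in> L" "\<And>v. v \<in> L \<Longrightarrow> \<pi> (\<pi> v) = v" "\<And>v. v \<in> L \<Longrightarrow> \<pi> v \<noteq> v"
    and "card L = 2 * q"
  shows "\<exists>e. bij_betw e L ({..<q} \<times> {..<2::nat}) \<and> (\<forall>v\<in>L. e (\<pi> v) = (fst (e v), 1 - snd (e v :: nat \<times> nat)))"
  using assms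
proof (induction q arbitrary: L)
  case 0
  then show ?case by (auto simp: bij_betw_def)
next
  case (Suc q)
  have "L \<noteq> {}" using Suc.prems by auto
  then obtain a where a: "a \<in> L" by blast
  define b where "b = \<pi> a"
  have b: "b \<in> L" "b \<noteq> a" "\<pi> b = a" using Suc.prems a by (auto simp: b_def)
  define L' where "L' = L - {a, b}"
  have L: "L = insert a (insert b L')" "a \<notin> insert b L'" "b \<notin> L'" using a b by (auto simp: L'_def)
  have fin: "finite L'" using Suc.prems(1) by (simp add: L'_def)
  have closed: "\<pi> v \<in> L'" if v: "v \<in> L'" for v
  proof -
    have "v \<in> L" "v \<noteq> a" "v \<noteq> b" using v by (auto simp: L'_def)
    then have "\<pi> v \<in> L" "\<pi> (\<pi> v) = v" using Suc.prems(2,3) by blast+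
    moreover have "\<pi> v \<noteq> a" using \<open>v \<noteq> b\<close> \<open>\<pi> (\<pi> v) = v\<close> by (auto simp: b_def)
    moreover have "\<pi> v \<noteq> b" using \<open>v \<noteq> a\<close> \<open>\<pi> (\<pi> v) = v\<close> b(3) by auto
    ultimately show ?thesis by (simp add: L'_def)
  qed
  have inv: "\<pi> (\<pi> v) = v" and nofix: "\<pi> v \<noteq> v" if "v \<in> L'" for v
    using that Suc.prems(3,4)[of v] by (auto simp: L'_def)
  have card: "card L' = 2 * q" using Suc.prems(5) L fin by simp
  then obtain e where e: "bij_betw e L' ({..<q} \<times> {..<2::nat})"
    and e\<pi>: "\<forall>v\<in>L'. e (\<pi> v) = (fst (e v), 1 - snd (e v))"
    using Suc.IH[OF fin closed inv nofix card] by blast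
  define f where "f v = (if v = a then (q, 0) else if v = b then (q, 1) else e v)" for v
  have fL': "f v = e v" if "v \<in> L'" for v using that by (auto simp: f_def L'_def)
  have fab: "f a = (q, 0)" "f b = (q, 1)" using b by (auto simp: f_def)
  have 1: "bij_betw f L' ({..<q} \<times> {..<2::nat})" using e fL' by (metis bij_betw_cong)
  have 2: "bij_betw f {a, b} ({q} \<times> {..<2::nat})"
    using fab b by (auto simp: bij_betw_def lessThan_Suc numeral_2_eq_2)
  have "bij_betw f (L' \<union> {a, b}) ({..<q} \<times> {..<2} \<union> {q} \<times> {..<2::nat})"
    by (rule bij_betw_combine[OF 1 2]) auto
  moreover have "L' \<union> {a, b} = L" using L by auto
  moreover have "{..<q} \<times> {..<2} \<union> {q} \<times> {..<2} = {..<Suc q} \<times> {..<2::nat}" by auto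
  ultimately have "bij_betw f L ({..<Suc q} \<times> {..<2::nat})" by simp
  moreover have "f (\<pi> v) = (fst (f v), 1 - snd (f v))" if v: "v \<in> L" for v
  proof -
    consider "v = a" | "v = b" | "v \<in> L'" using v L by auto
    then show ?thesis
    proof cases
      case 1
      then show ?thesis using fab by (simp flip: b_def)
    next
      case 2
      then show ?thesis using fab b by simp
    next
      case 3
      then show ?thesis using e\<pi> closed fL' by simp
    qed
  qed
  ultimately show ?case by blast
qed

context cone_over_cycle_and_edges
begin

definition rim_path where
  "rim_path xs \<longleftrightarrow> distinct xs \<and> set xs \<subseteq> R \<and> (\<forall>i. Suc i < length xs \<longrightarrow> xs ! Suc i \<in> nb (xs ! i))"

lemma nb_eq:
  assumes "v \<in> R" "a \<in> nb v" "b \<in> nb v" "a \<noteq> b"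
  shows "nb v = {a, b}"
proof (rule card_seteq[symmetric])
  show "card (nb v) \<le> card {a, b}" using assms by (simp add: R_def h_def)
qed (use assms in auto)

lemma card_nb_R: "v \<in> R \<Longrightarrow> card (nb v) = 2"
  by (simp add: R_def h_def)

lemma nb_sym_R: "v \<in> R \<Longrightarrow> w \<in> nb v \<Longrightarrow> v \<in> nb w"
  using nb_sym by (simp add: R_def)

text \<open>Take a longest path in \<open>R\<close>. Both neighbours of its last vertex lie on it. An interior vertex has
  its two neighbours next to it on the path, so the last vertex is adjacent to the first: the path
  closes up to a cycle, which contains all neighbours of its vertices and so is all of \<open>R\<close>.\<close>

lemma rim_cycle:
  obtains xs where "distinct xs" "set xs = R" "length xs = k"
    "\<And>i. i < k \<Longrightarrow> xs ! (Suc i mod k) \<in> nb (xs ! i)"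
proof -
  have bound: "length xs \<le> k" if "rim_path xs" for xs
    using that card_mono[of R "set xs"] by (auto simp: rim_path_def distinct_card card_R)
  have "R \<noteq> {}" using card_R k4 by auto
  then obtain r where "r \<in> R" by blast
  then have r: "rim_path [r]" by (simp add: rim_path_def)
  define l where "l = Max (length ` Collect rim_path)"
  have fin: "finite (length ` Collect rim_path)"
    by (rule finite_subset[of _ "{..k}"]) (use bound in auto)
  have "l \<in> length ` Collect rim_path" unfolding l_def by (rule Max_in[OF fin]) (use r in auto)
  then obtain xs where xs: "rim_path xs" "length xs = l" by auto
  have max: "length ys \<le> l" if "rim_path ys" for ys
    unfolding l_def by (rule Max_ge[OF fin]) (use that in auto)
  have dist: "distinct xs" and sub: "set xs \<subseteq> R"
    and step: "\<And>i. Suc i < l \<Longrightarrow> xs ! Suc i \<in> nb (xs ! i)"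
    using xs by (auto simp: rim_path_def)
  have mem: "xs ! i \<in> R" if "i < l" for i using that xs(2) sub by auto
  have inj: "xs ! i = xs ! j \<longleftrightarrow> i = j" if "i < l" "j < l" for i j
    using that dist xs(2) by (simp add: nth_eq_iff_index_eq)
  have "l \<ge> 1" using max[OF r] by simp
  define m where "m = l - 1"
  have m: "l = Suc m" using \<open>l \<ge> 1\<close> by (simp add: m_def)
  have last_nb: "nb (xs ! m) \<subseteq> set xs"
  proof (rule subsetI, rule ccontr)
    fix w assume w: "w \<in> nb (xs ! m)" "w \<notin> set xs"
    \<comment> \<open>otherwise the path could be extended\<close>
    have "rim_path (xs @ [w])"
      unfolding rim_path_def
    proof (intro conjI allI impI)
      show "distinct (xs @ [w])" using dist w by simp
      show "set (xs @ [w]) \<subseteq> R" using sub w nb_R[OF mem[of m]] m by auto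
      fix i assume i: "Suc i < length (xs @ [w])"
      show "(xs @ [w]) ! Suc i \<in> nb ((xs @ [w]) ! i)"
      proof (cases "Suc i < l")
        case True
        then show ?thesis using step xs(2) by (simp add: nth_append)
      next
        case False
        then have "i = m" using i xs(2) m by simp
        then show ?thesis using w xs(2) m by (simp add: nth_append)
      qed
    qed
    from max[OF this] show False using xs(2) by simp
  qed
  \<comment> \<open>an interior vertex of the path has both its neighbours on the path already\<close>
  have ends: "j = 0 \<or> Suc j = m" if j: "j < l" "xs ! j \<in> nb (xs ! m)" for j
  proof (rule ccontr)
    assume neg: "\<not> (j = 0 \<or> Suc j = m)"
    have "j \<noteq> m" using j(2) by (auto simp: mem_nb)
    then obtain i where i: "j = Suc i" "Suc (Suc j) \<le> m" using neg j m by (cases j) auto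
    have "xs ! i \<in> nb (xs ! j)" using nb_sym_R[OF mem step, of i] i m by simp
    moreover have "xs ! Suc j \<in> nb (xs ! j)" using step i m by simp
    moreover have "xs ! i \<noteq> xs ! Suc j" using inj i m by simp
    ultimately have "nb (xs ! j) = {xs ! i, xs ! Suc j}" using mem[OF j(1)] by (intro nb_eq)
    moreover have "xs ! m \<in> nb (xs ! j)" using nb_sym_R[OF mem j(2)] m by simp
    ultimately show False using inj[of m i] inj[of m "Suc j"] i m by auto
  qed
  have nbm: "nb (xs ! m) \<subseteq> {xs ! 0, xs ! (m - 1)}"
  proof
    fix w assume w: "w \<in> nb (xs ! m)"
    then obtain j where "j < l" "w = xs ! j" using last_nb xs(2) by (metis in_set_conv_nth subsetD)
    then show "w \<in> {xs ! 0, xs ! (m - 1)}" using ends[of j] w by auto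
  qed
  have c2: "card (nb (xs ! m)) = 2" using mem m by (intro card_nb_R) simp
  have "m \<ge> 2"
  proof (rule ccontr)
    assume "\<not> m \<ge> 2"
    then have "m - 1 = 0" by simp
    then have "nb (xs ! m) \<subseteq> {xs ! 0}" using nbm by simp
    then have "card (nb (xs ! m)) \<le> card {xs ! 0}" by (intro card_mono) auto
    then show False using c2 by simp
  qed
  have "nb (xs ! m) = {xs ! 0, xs ! (m - 1)}"
    by (rule card_seteq) (use nbm c2 in \<open>auto simp: card_insert_if\<close>)
  then have close: "xs ! (Suc i mod l) \<in> nb (xs ! i)" if "i < l" for i
    using that step[of i] m by (cases "i = m") auto
  have closed: "nb v \<subseteq> set xs" if v: "v \<in> set xs" for v
  proof -
    obtain i where i: "i < l" "v = xs ! i" using v xs(2) by (metis in_set_conv_nth)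
    define p where "p = (if i = 0 then m else i - 1)"
    have p: "p < l" "Suc p mod l = i" using i m by (auto simp: p_def)
    have "xs ! p \<in> nb v" using nb_sym_R[OF mem close, of p] p i by simp
    moreover have "xs ! (Suc i mod l) \<in> nb v" using close i by simp
    moreover have "p \<noteq> Suc i mod l" using i m \<open>m \<ge> 2\<close> by (auto simp: p_def mod_Suc)
    then have "xs ! p \<noteq> xs ! (Suc i mod l)" using inj p m by simp
    ultimately have "nb v = {xs ! p, xs ! (Suc i mod l)}" using mem[OF i(1)] i(2) by (intro nb_eq) auto
    then show ?thesis using p m xs(2) by auto
  qed
  have "set xs \<noteq> {}" using xs m by auto
  then have "set xs = R" using connected[OF sub _ closed] by blast
  moreover from this have "l = k" using dist xs(2) card_R by (metis distinct_card)
  ultimately show ?thesis using that dist xs(2) close by blast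
qed

lemma nb_rim_cycle:
  assumes xs: "distinct xs" "set xs = R" "length xs = k"
    and step: "\<And>i. i < k \<Longrightarrow> xs ! (Suc i mod k) \<in> nb (xs ! i)"
    and ij: "i < k" "j < k"
  shows "adj (xs ! i) (xs ! j) \<longleftrightarrow> j = Suc i mod k \<or> i = Suc j mod k"
proof
  have mem: "xs ! i \<in> R" if "i < k" for i using nth_mem[of i xs] that xs by simp
  have inj: "xs ! i = xs ! j \<longleftrightarrow> i = j" if "i < k" "j < k" for i j
    using that xs by (simp add: nth_eq_iff_index_eq)
  show "adj (xs ! i) (xs ! j)" if "j = Suc i mod k \<or> i = Suc j mod k"
    using that
  proof
    assume "j = Suc i mod k"
    then show ?thesis using step[OF ij(1)] by (simp add: mem_nb)
  next
    assume "i = Suc j mod k"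
    then have "adj (xs ! j) (xs ! i)" using step[OF ij(2)] by (simp add: mem_nb)
    then show ?thesis by (rule adj_sym)
  qed
  assume "adj (xs ! i) (xs ! j)"
  moreover have "xs ! j \<noteq> z"
  proof -
    have "xs ! j \<in> W" using mem[OF ij(2)] by (simp add: R_def)
    then show ?thesis by (simp add: W_def)
  qed
  ultimately have j: "xs ! j \<in> nb (xs ! i)" by (simp add: mem_nb)
  define p where "p = (if i = 0 then k - 1 else i - 1)"
  have p: "p < k" "Suc p mod k = i" using ij k4 by (auto simp: p_def)
  have "xs ! p \<in> nb (xs ! i)" using nb_sym_R[OF mem step, of p] p by simp
  moreover have "xs ! (Suc i mod k) \<in> nb (xs ! i)" using step ij by simp
  moreover have "p \<noteq> Suc i mod k" using ij k4 by (auto simp: p_def mod_Suc split: if_splits)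
  then have "xs ! p \<noteq> xs ! (Suc i mod k)" using inj p ij by simp
  ultimately have "nb (xs ! i) = {xs ! p, xs ! (Suc i mod k)}" using mem[OF ij(1)] by (intro nb_eq)
  then have "j = p \<or> j = Suc i mod k" using j inj[OF ij(2)] p ij by auto
  then show "j = Suc i mod k \<or> i = Suc j mod k" using p by auto
qed

lemma leaf_enumeration:
  obtains e where "bij_betw e {v \<in> W. h v = 1} ({..<q} \<times> {..<2::nat})"
    "\<And>u v. u \<in> W \<Longrightarrow> h u = 1 \<Longrightarrow> v \<in> W \<Longrightarrow> h v = 1 \<Longrightarrow>
      adj u v \<longleftrightarrow> fst (e u) = fst (e v) \<and> snd (e u) \<noteq> snd (e v)"
proof -
  define L where "L = {v \<in> W. h v = 1}"
  have "\<forall>v\<in>L. \<exists>w. nb v = {w}" by (simp add: L_def h_def card_1_singleton_iff)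
  then obtain \<pi> where \<pi>: "\<And>v. v \<in> L \<Longrightarrow> nb v = {\<pi> v}" using bchoice[of L "\<lambda>v w. nb v = {w}"] by blast
  have \<pi>_nb: "\<pi> v \<in> nb v" if "v \<in> L" for v using \<pi>[OF that] by simp
  have \<pi>L: "\<pi> v \<in> L" if v: "v \<in> L" for v
    using v nb_W[OF \<pi>_nb[OF v]] same_h[OF _ \<pi>_nb[OF v]] by (simp add: L_def)
  have \<pi>\<pi>: "\<pi> (\<pi> v) = v" if v: "v \<in> L" for v
  proof -
    have "v \<in> W" using v by (simp add: L_def)
    from nb_sym[OF this \<pi>_nb[OF v]] have "v \<in> nb (\<pi> v)" .
    then show ?thesis using \<pi>[OF \<pi>L[OF v]] by simp
  qed
  have \<pi>_ne: "\<pi> v \<noteq> v" if "v \<in> L" for v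
  proof
    assume "\<pi> v = v"
    then show False using \<pi>_nb[OF that] by (simp add: mem_nb)
  qed
  have "finite L" "card L = 2 * q" using card_1 by (simp_all add: L_def)
  then obtain e where e: "bij_betw e L ({..<q} \<times> {..<2::nat})"
    and e\<pi>: "\<And>v. v \<in> L \<Longrightarrow> e (\<pi> v) = (fst (e v), 1 - snd (e v))"
    using pairing_enumeration[of L \<pi> q] \<pi>L \<pi>\<pi> \<pi>_ne by blast
  have "adj u v \<longleftrightarrow> fst (e u) = fst (e v) \<and> snd (e u) \<noteq> snd (e v)" if uv: "u \<in> L" "v \<in> L" for u v
  proof -
    have "v \<noteq> z" using uv by (auto simp: L_def)
    then have "adj u v \<longleftrightarrow> v \<in> nb u" by (simp add: mem_nb)
    also have "\<dots> \<longleftrightarrow> v = \<pi> u" using \<pi>[OF uv(1)] by simp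
    also have "\<dots> \<longleftrightarrow> e v = e (\<pi> u)"
      using inj_on_eq_iff[OF bij_betw_imp_inj_on[OF e] uv(2) \<pi>L[OF uv(1)]] by simp
    also have "\<dots> \<longleftrightarrow> fst (e u) = fst (e v) \<and> snd (e v) = 1 - snd (e u)"
      using e\<pi>[OF uv(1)] by (auto simp: prod_eq_iff)
    also have "snd (e v) = 1 - snd (e u) \<longleftrightarrow> snd (e u) \<noteq> snd (e v)"
    proof -
      have "e u \<in> {..<q} \<times> {..<2}" "e v \<in> {..<q} \<times> {..<2}" using bij_betwE[OF e] uv by blast+
      then have "snd (e u) < 2" "snd (e v) < 2" by (simp_all add: mem_Times_iff)
      then have "snd (e u) = 0 \<or> snd (e u) = 1" "snd (e v) = 0 \<or> snd (e v) = 1" by linarith+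
      then show ?thesis by (elim disjE) simp_all
    qed
    finally show ?thesis .
  qed
  then show ?thesis using that[of e] e by (simp add: L_def)
qed

end

section \<open>The concrete graph\<close>

definition cone_model :: "nat \<Rightarrow> nat \<Rightarrow> nat \<Rightarrow> (nat + nat + (nat \<times> nat) + (nat \<times> nat)) pair_pre_digraph" where
  "cone_model k q s = complete_graph 1 \<or>\<^sub>g
      (cycle_graph k \<squnion>\<^sub>g q \<cdot>\<^sub>g complete_graph 2 \<squnion>\<^sub>g s \<cdot>\<^sub>g complete_graph 1)"

lemma arcs_disj_union:
  "(Inl a, Inl b) \<in> parcs (G \<squnion>\<^sub>g H) \<longleftrightarrow> (a, b) \<in> parcs G"
  "(Inr c, Inr d) \<in> parcs (G \<squnion>\<^sub>g H) \<longleftrightarrow> (c, d) \<in> parcs H"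
  "(Inl a, Inr d) \<notin> parcs (G \<squnion>\<^sub>g H)"
  "(Inr c, Inl b) \<notin> parcs (G \<squnion>\<^sub>g H)"
  by (force simp: disj_union_def)+

lemma arcs_graph_join:
  "(Inl a, Inl b) \<in> parcs (G \<or>\<^sub>g H) \<longleftrightarrow> (a, b) \<in> parcs G"
  "(Inr c, Inr d) \<in> parcs (G \<or>\<^sub>g H) \<longleftrightarrow> (c, d) \<in> parcs H"
  "(Inl a, Inr d) \<in> parcs (G \<or>\<^sub>g H) \<longleftrightarrow> a \<in> pverts G \<and> d \<in> pverts H"
  "(Inr c, Inl b) \<in> parcs (G \<or>\<^sub>g H) \<longleftrightarrow> c \<in> pverts H \<and> b \<in> pverts G"
  by (force simp: graph_join_def disj_union_def)+

lemma arcs_copies: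
  "(x, y) \<in> parcs (r \<cdot>\<^sub>g H) \<longleftrightarrow> fst x < r \<and> fst x = fst y \<and> (snd x, snd y) \<in> parcs H"
  by (cases x; cases y) (simp add: copies_def)

lemma pverts_disj_union: "pverts (G \<squnion>\<^sub>g H) = pverts G <+> pverts H"
  and pverts_copies: "pverts (r \<cdot>\<^sub>g H) = {..<r} \<times> pverts H"
  by (simp_all add: disj_union_def copies_def)

lemma verts_cone_model:
  "pverts (cone_model k q s) = insert (Inl 0) (Inr ` (Inl ` {..<k} \<union> Inr ` (Inl ` ({..<q} \<times> {..<2}) \<union> Inr ` ({..<s} \<times> {0}))))"
  by (auto simp: cone_model_def graph_join_def disj_union_def copies_def complete_graph_def cycle_graph_def)

lemma arcs_cone_model:
  "(Inl a, Inl b) \<notin> parcs (cone_model k q s)"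
  "(Inl a, Inr y) \<in> parcs (cone_model k q s) \<longleftrightarrow> a = 0 \<and> Inr y \<in> pverts (cone_model k q s)"
  "(Inr y, Inl a) \<in> parcs (cone_model k q s) \<longleftrightarrow> a = 0 \<and> Inr y \<in> pverts (cone_model k q s)"
  "(Inr (Inl i), Inr (Inl j)) \<in> parcs (cone_model k q s)
    \<longleftrightarrow> i < k \<and> j < k \<and> (j = Suc i mod k \<or> i = Suc j mod k)"
  "(Inr (Inl i), Inr (Inr w)) \<notin> parcs (cone_model k q s)"
  "(Inr (Inr w), Inr (Inl i)) \<notin> parcs (cone_model k q s)"
  "(Inr (Inr (Inl e)), Inr (Inr (Inl e'))) \<in> parcs (cone_model k q s)
    \<longleftrightarrow> fst e < q \<and> fst e = fst e' \<and> snd e < 2 \<and> snd e' < 2 \<and> snd e \<noteq> snd e'"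
  "(Inr (Inr (Inl e)), Inr (Inr (Inr d))) \<notin> parcs (cone_model k q s)"
  "(Inr (Inr (Inr d)), Inr (Inr (Inl e))) \<notin> parcs (cone_model k q s)"
  "(Inr (Inr (Inr d)), Inr (Inr (Inr d'))) \<notin> parcs (cone_model k q s)"
  unfolding verts_cone_model
  by (auto simp: cone_model_def arcs_graph_join arcs_disj_union arcs_copies pverts_disj_union pverts_copies
      complete_graph_def cycle_graph_def)

lemma pair_graph_cone_model: "k \<ge> 4 \<Longrightarrow> pair_graph (cone_model k q s)"
  unfolding cone_model_def
  by (intro pair_graph_graph_join pair_graph_disj_union pair_graph_copies pair_graph_complete_graph
      pair_graph_cycle_graph) simp

lemma cone_model_cone:
  assumes "k \<ge> 4"
  shows "cone (cone_model k q s) (Inl 0)"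
proof (intro cone.intro simple_graph.intro cone_axioms.intro)
  show "pair_graph (cone_model k q s)" by (rule pair_graph_cone_model[OF assms])
  show "Inl 0 \<in> pverts (cone_model k q s)" by (simp add: verts_cone_model)
  show "(Inl 0, v) \<in> parcs (cone_model k q s)" if "v \<in> pverts (cone_model k q s)" "v \<noteq> Inl 0" for v
    using that by (cases v) (auto simp: arcs_cone_model verts_cone_model)
qed

lemma cone_model_instance:
  assumes k: "k \<ge> 4"
  shows "cone_over_cycle_and_edges (cone_model k q s) (Inl 0) k q s"
proof -
  let ?G = "cone_model k q s"
  interpret cone ?G "Inl 0" by (rule cone_model_cone[OF k])
  have W: "W = Inr ` (Inl ` {..<k} \<union> Inr ` (Inl ` ({..<q} \<times> {..<2}) \<union> Inr ` ({..<s} \<times> {0})))"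
    by (auto simp: W_def verts_cone_model)
  define p where "p i = (if i = 0 then k - 1 else i - 1)" for i
  have p: "i = Suc j mod k \<longleftrightarrow> j = p i" if "i < k" "j < k" for i j
    using that by (auto simp: p_def mod_Suc)
  have p_less: "p i < k" "p i \<noteq> Suc i mod k" if "i < k" for i
    using that k by (auto simp: p_def mod_Suc)
  have nb_cycle: "nb (Inr (Inl i)) = {Inr (Inl (Suc i mod k)), Inr (Inl (p i))}" if "i < k" for i
  proof
    show "nb (Inr (Inl i)) \<subseteq> {Inr (Inl (Suc i mod k)), Inr (Inl (p i))}"
    proof
      fix x assume x: "x \<in> nb (Inr (Inl i))"
      then show "x \<in> {Inr (Inl (Suc i mod k)), Inr (Inl (p i))}"
        using nb_W[OF x] p[OF that] unfolding W mem_nb by (auto simp: arcs_cone_model)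
    qed
    show "{Inr (Inl (Suc i mod k)), Inr (Inl (p i))} \<subseteq> nb (Inr (Inl i))"
      using that k p_less[OF that] p[OF that, of "p i"] by (simp add: mem_nb arcs_cone_model)
  qed
  have nb_edge: "nb (Inr (Inr (Inl (j, b)))) = {Inr (Inr (Inl (j, 1 - b)))}" if "j < q" "b < 2" for j b
  proof
    show "nb (Inr (Inr (Inl (j, b)))) \<subseteq> {Inr (Inr (Inl (j, 1 - b)))}"
    proof
      fix x assume x: "x \<in> nb (Inr (Inr (Inl (j, b))))"
      then show "x \<in> {Inr (Inr (Inl (j, 1 - b)))}"
        using nb_W[OF x] that unfolding W mem_nb by (auto simp: arcs_cone_model)
    qed
    show "{Inr (Inr (Inl (j, 1 - b)))} \<subseteq> nb (Inr (Inr (Inl (j, b))))"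
    proof -
      have "b \<noteq> 1 - b" by arith
      then show ?thesis using that by (simp add: mem_nb arcs_cone_model)
    qed
  qed
  have nb_point: "nb (Inr (Inr (Inr d))) = {}" for d
  proof -
    have "x \<notin> nb (Inr (Inr (Inr d)))" if "x \<in> W" for x
      using that unfolding W mem_nb by (auto simp: arcs_cone_model)
    then show ?thesis using nb_W by blast
  qed
  have h: "i < k \<Longrightarrow> h (Inr (Inl i)) = 2" "j < q \<Longrightarrow> b < 2 \<Longrightarrow> h (Inr (Inr (Inl (j, b)))) = 1"
    "h (Inr (Inr (Inr d))) = 0" for i j b d
    using p_less[of i] by (auto simp: h_def nb_cycle nb_edge nb_point)
  have sets: "{v \<in> W. h v = 2} = (Inr \<circ> Inl) ` {..<k}"
    "{v \<in> W. h v = 1} = (Inr \<circ> Inr \<circ> Inl) ` ({..<q} \<times> {..<2})"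
    "{v \<in> W. h v = 0} = (Inr \<circ> Inr \<circ> Inr) ` ({..<s} \<times> {0})"
    unfolding W by (auto simp: h)
  interpret cone_over_low_degree ?G "Inl 0" k q s
  proof
    show "h v \<le> 2" if "v \<in> W" for v using that unfolding W by (auto simp: h)
    show "card {v \<in> W. h v = 2} = k" unfolding sets by (subst card_image) (auto simp: inj_on_def)
    show "card {v \<in> W. h v = 1} = 2 * q" unfolding sets by (subst card_image) (auto simp: inj_on_def)
    show "card {v \<in> W. h v = 0} = s" unfolding sets by (subst card_image) (auto simp: inj_on_def)
  qed
  show ?thesis
  proof
    show "k \<ge> 4" by (rule k)
    show "h w = h v" if "v \<in> W" "w \<in> nb v" for v w
      using that p_less k unfolding W by (auto simp: h nb_cycle nb_edge nb_point less_2_cases_iff)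
    fix A assume A: "A \<subseteq> R" "A \<noteq> {}" "\<And>v. v \<in> A \<Longrightarrow> nb v \<subseteq> A"
    have R: "R = (Inr \<circ> Inl) ` {..<k}" unfolding R_def by (rule sets)
    obtain a where a: "a < k" "Inr (Inl a) \<in> A" using A(1,2) R by auto
    have all: "Inr (Inl ((a + m) mod k)) \<in> A" for m
    proof (induction m)
      case 0
      then show ?case using a by simp
    next
      case (Suc m)
      have "(a + m) mod k < k" using k by simp
      then have "Inr (Inl (Suc ((a + m) mod k) mod k)) \<in> A" using A(3)[OF Suc] nb_cycle by auto
      then show ?case by (simp add: mod_Suc_eq)
    qed
    have "Inr (Inl i) \<in> A" if "i < k" for i
      using all[of "k - a + i"] a that by simp
    then have "R \<subseteq> A" unfolding R by auto
    then show "A = R" using A(1) by blast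
  qed
qed

text \<open>The axioms of the locale describe the graph up to isomorphism: number the vertices of degree 2 along
  the cycle, the leaves by pairs, and the isolated base vertices arbitrarily.\<close>

lemma (in cone_over_cycle_and_edges) iso_cone_model: "G \<simeq> cone_model k q s"
proof -
  let ?M = "cone_model k q s"
  obtain xs where xs: "distinct xs" "set xs = R" "length xs = k"
    and step: "\<And>i. i < k \<Longrightarrow> xs ! (Suc i mod k) \<in> nb (xs ! i)"
    by (rule rim_cycle) blast
  note cyc = nb_rim_cycle[OF xs step]
  define L S where "L = {v \<in> W. h v = 1}" and "S = {v \<in> W. h v = 0}"
  obtain e where e': "bij_betw e {v \<in> W. h v = 1} ({..<q} \<times> {..<2::nat})"
    and adj_e': "\<And>u v. u \<in> W \<Longrightarrow> h u = 1 \<Longrightarrow> v \<in> W \<Longrightarrow> h v = 1 \<Longrightarrow>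
      adj u v \<longleftrightarrow> fst (e u) = fst (e v) \<and> snd (e u) \<noteq> snd (e v)"
    by (rule leaf_enumeration) blast
  have e: "bij_betw e L ({..<q} \<times> {..<2::nat})" using e' by (simp only: L_def)
  have adj_e: "adj u v \<longleftrightarrow> fst (e u) = fst (e v) \<and> snd (e u) \<noteq> snd (e v)" if "u \<in> L" "v \<in> L" for u v
    using that by (intro adj_e') (simp_all add: L_def)
  have "finite S" "card S = s" using card_0 by (simp_all add: S_def)
  then obtain d where d: "bij_betw d S {..<s}"
    using ex_bij_betw_finite_nat[of S] by (auto simp: atLeast0LessThan)
  define c where "c = inv_into {..<k} (\<lambda>i. xs ! i)"
  have xs_bij: "bij_betw (\<lambda>i. xs ! i) {..<k} R"
    using bij_betw_nth[OF xs(1), of "{..<k}" R] xs by simp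
  have c: "bij_betw c R {..<k}" unfolding c_def by (rule bij_betw_inv_into[OF xs_bij])
  have xs_c: "xs ! c v = v" if "v \<in> R" for v
    unfolding c_def using that xs_bij by (intro f_inv_into_f) (auto simp: bij_betw_def)
  have WRLS: "W = R \<union> L \<union> S"
  proof -
    have "v \<in> R \<union> L \<union> S" if "v \<in> W" for v
    proof -
      have "h v = 2 \<or> h v = 1 \<or> h v = 0" using h_le_2[OF that] by linarith
      then show ?thesis using that by (auto simp: R_def L_def S_def)
    qed
    moreover have "R \<union> L \<union> S \<subseteq> W" by (auto simp: R_def L_def S_def)
    ultimately show ?thesis by blast
  qed
  have disj: "R \<inter> L = {}" "(R \<union> L) \<inter> S = {}" "z \<notin> R \<union> L \<union> S" by (auto simp: R_def L_def S_def)
  define f :: "'a \<Rightarrow> nat + nat + (nat \<times> nat) + (nat \<times> nat)" where "f v = (if v = z then Inl 0 else if v \<in> R then Inr (Inl (c v))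
     else if v \<in> L then Inr (Inr (Inl (e v))) else Inr (Inr (Inr (d v, 0))))" for v
  have fz: "f z = Inl 0" and fR: "\<And>v. v \<in> R \<Longrightarrow> f v = Inr (Inl (c v))"
    and fL: "\<And>v. v \<in> L \<Longrightarrow> f v = Inr (Inr (Inl (e v)))"
    and fS: "\<And>v. v \<in> S \<Longrightarrow> f v = Inr (Inr (Inr (d v, 0)))"
    using disj by (auto simp: f_def)
  have bij: "bij_betw f V (pverts ?M)"
  proof -
    have "bij_betw f {z} {Inl 0}" using fz by (simp add: bij_betw_def)
    moreover have "bij_betw f R ((Inr \<circ> Inl) ` {..<k})"
    proof -
      have eq: "bij_betw f R A \<longleftrightarrow> bij_betw ((Inr \<circ> Inl) \<circ> c) R A" for A
        by (rule bij_betw_cong) (simp add: fR)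
      show ?thesis unfolding eq by (rule bij_betw_trans[OF c]) (auto simp: bij_betw_def inj_on_def)
    qed
    moreover have "bij_betw f L ((Inr \<circ> Inr \<circ> Inl) ` ({..<q} \<times> {..<2}))"
    proof -
      have eq: "bij_betw f L A \<longleftrightarrow> bij_betw ((Inr \<circ> Inr \<circ> Inl) \<circ> e) L A" for A
        by (rule bij_betw_cong) (simp add: fL)
      show ?thesis unfolding eq by (rule bij_betw_trans[OF e]) (auto simp: bij_betw_def inj_on_def)
    qed
    moreover have "bij_betw f S ((\<lambda>i. Inr (Inr (Inr (i, 0)))) ` {..<s})"
    proof -
      have eq: "bij_betw f S A \<longleftrightarrow> bij_betw ((\<lambda>i. Inr (Inr (Inr (i, 0)))) \<circ> d) S A" for A
        by (rule bij_betw_cong) (simp add: fS)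
      show ?thesis unfolding eq by (rule bij_betw_trans[OF d]) (auto simp: bij_betw_def inj_on_def)
    qed
    ultimately have "bij_betw f ({z} \<union> R \<union> L \<union> S) ({Inl 0} \<union> (Inr \<circ> Inl) ` {..<k}
        \<union> (Inr \<circ> Inr \<circ> Inl) ` ({..<q} \<times> {..<2}) \<union> (\<lambda>i. Inr (Inr (Inr (i, 0)))) ` {..<s})"
      by (intro bij_betw_combine) auto
    moreover have "{z} \<union> R \<union> L \<union> S = V" unfolding V_eq WRLS by auto
    moreover have "{Inl 0} \<union> (Inr \<circ> Inl) ` {..<k}
        \<union> (Inr \<circ> Inr \<circ> Inl) ` ({..<q} \<times> {..<2}) \<union> (\<lambda>i. Inr (Inr (Inr (i, 0)))) ` {..<s} = pverts ?M"
      by (auto simp: verts_cone_model)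
    ultimately show ?thesis by simp
  qed
  have fV: "f v \<in> pverts ?M" if "v \<in> V" for v using bij_betwE[OF bij] that by blast
  have sep: "\<not> adj u v" if "u \<in> W" "v \<in> W" "h u \<noteq> h v" for u v
  proof
    assume "adj u v"
    moreover have "v \<noteq> z" using that by auto
    ultimately have "v \<in> nb u" by (simp add: mem_nb)
    then show False using same_h that by auto
  qed
  have isolated: "\<not> adj u v" if "u \<in> S" "v \<in> W" for u v
  proof
    assume "adj u v"
    moreover have "v \<noteq> z" using that by auto
    ultimately have "v \<in> nb u" by (simp add: mem_nb)
    moreover have "nb u = {}" using that(1) by (simp add: S_def h_def)
    ultimately show False by simp
  qed
  have hR: "\<And>v. v \<in> R \<Longrightarrow> v \<in> W \<and> h v = 2" and hL: "\<And>v. v \<in> L \<Longrightarrow> v \<in> W \<and> h v = 1"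
    and hS: "\<And>v. v \<in> S \<Longrightarrow> v \<in> W \<and> h v = 0"
    by (auto simp: R_def L_def S_def)
  have arc: "adj u v \<longleftrightarrow> (f u, f v) \<in> parcs ?M" if uv: "u \<in> V" "v \<in> V" for u v
  proof -
    consider "u = z" "v = z" | "u = z" "v \<in> W" | "u \<in> W" "v = z" | "u \<in> R" "v \<in> R"
      | "u \<in> L" "v \<in> L" | "u \<in> S" "v \<in> S" | "u \<in> R" "v \<in> L" | "u \<in> R" "v \<in> S"
      | "u \<in> L" "v \<in> R" | "u \<in> L" "v \<in> S" | "u \<in> S" "v \<in> R" | "u \<in> S" "v \<in> L"
      using uv unfolding V_eq WRLS by auto
    then show ?thesis
    proof cases
      case 1
      then show ?thesis by (simp add: fz arcs_cone_model)
    next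
      case 2
      then have "v \<noteq> z" by auto
      moreover have "f v \<noteq> Inl 0" "\<exists>y. f v = Inr y" using \<open>v \<noteq> z\<close> by (auto simp: f_def)
      ultimately show ?thesis using 2 apex[of v] uv fV[of v] by (auto simp: fz arcs_cone_model)
    next
      case 3
      then have "u \<noteq> z" by auto
      moreover have "\<exists>y. f u = Inr y" using \<open>u \<noteq> z\<close> by (auto simp: f_def)
      moreover have "adj u z" using apex[OF uv(1) \<open>u \<noteq> z\<close>] by (rule adj_sym)
      ultimately show ?thesis using 3 uv fV[of u] by (auto simp: fz arcs_cone_model)
    next
      case 4
      then have "c u < k" "c v < k" using bij_betwE[OF c] by (simp_all add: lessThan_iff[symmetric] del: lessThan_iff)
      then show ?thesis using cyc[of "c u" "c v"] 4 by (simp add: fR xs_c arcs_cone_model)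
    next
      case 5
      then have "e u \<in> {..<q} \<times> {..<2}" "e v \<in> {..<q} \<times> {..<2}" using bij_betwE[OF e] by blast+
      then show ?thesis using adj_e[OF 5] 5 by (auto simp: fL arcs_cone_model)
    next
      case 6
      then show ?thesis using isolated[of u v] hS by (simp add: fS arcs_cone_model)
    next
      case 7
      then show ?thesis using sep[of u v] hR hL by (simp add: fR fL arcs_cone_model)
    next
      case 8
      then show ?thesis using sep[of u v] hR hS by (simp add: fR fS arcs_cone_model)
    next
      case 9
      then show ?thesis using sep[of u v] hR hL by (simp add: fR fL arcs_cone_model)
    next
      case 10
      then show ?thesis using sep[of u v] hS hL by (simp add: fS fL arcs_cone_model)
    next
      case 11
      then show ?thesis using sep[of u v] hR hS by (simp add: fR fS arcs_cone_model)
    next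
      case 12
      then show ?thesis using sep[of u v] hS hL by (simp add: fS fL arcs_cone_model)
    qed
  qed
  have "pair_graph ?M" by (rule pair_graph_cone_model[OF k4])
  then show ?thesis unfolding graph_iso_iff[OF pair_graph \<open>pair_graph ?M\<close>] using bij arc by blast
qed

section \<open>Cospectral graphs\<close>

lemma (in cone_over_cycle_and_edges) h_moments:
  shows "(\<Sum>v\<in>W. real (h v)) = 2 * k + 2 * q" and "(\<Sum>v\<in>W. real (h v)^2) = 4 * k + 2 * q"
    and "(\<Sum>v\<in>W. real (h v)^3) + real base_triangles = 8 * k + 2 * q"
  using sum_by_h[of "\<lambda>m. real m"] sum_by_h[of "\<lambda>m. real m^2"] sum_by_h[of "\<lambda>m. real m^3"]
    base_triangles_eq_0 by simp_all

text \<open>Subtracting three times the second moment and adding twice the first to the third leaves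
  \<open>\<Sum> h(h-1)(h-2)\<close> plus the triangle count equal to 0. The terms are nonnegative, so every \<open>h\<close> is
  at most 2, and then the moments are a linear system for the three degree counts.\<close>

lemma (in cone) low_degree_of_moments:
  assumes W: "card W = k + 2 * q + s"
    and m1: "(\<Sum>v\<in>W. real (h v)) = 2 * k + 2 * q" and m2: "(\<Sum>v\<in>W. real (h v)^2) = 4 * k + 2 * q"
    and m3: "(\<Sum>v\<in>W. real (h v)^3) + real base_triangles = 8 * k + 2 * q"
  shows "cone_over_low_degree G z k q s"
proof -
  define g :: "nat \<Rightarrow> real" where "g m = real m^3 - 3 * real m^2 + 2 * real m" for m
  have g: "g m \<ge> 0" "g m = 0 \<longleftrightarrow> m \<le> 2" for m
  proof -
    have eq: "g m = real m * ((real m - 1) * (real m - 2))"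
      by (simp add: g_def power2_eq_square power3_eq_cube algebra_simps)
    show "g m = 0 \<longleftrightarrow> m \<le> 2" unfolding eq by auto
    show "g m \<ge> 0"
    proof (cases "m \<le> 1")
      case True
      then have "m = 0 \<or> m = 1" by linarith
      then show ?thesis unfolding eq by auto
    next
      case False
      then show ?thesis unfolding eq by (intro mult_nonneg_nonneg) auto
    qed
  qed
  have "(\<Sum>v\<in>W. g (h v)) + real base_triangles = 0"
    using m1 m2 m3 by (simp add: g_def sum.distrib sum_subtractf flip: sum_distrib_left)
  moreover have "(\<Sum>v\<in>W. g (h v)) \<ge> 0" by (intro sum_nonneg g)
  ultimately have "(\<Sum>v\<in>W. g (h v)) = 0" by simp
  then have "\<forall>v\<in>W. g (h v) = 0" by (subst (asm) sum_nonneg_eq_0_iff) (auto simp: g)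
  then have le2: "h v \<le> 2" if "v \<in> W" for v using that g(2) by blast
  define n0 n1 n2 where "n0 = card {v \<in> W. h v = 0}" and "n1 = card {v \<in> W. h v = 1}"
    and "n2 = card {v \<in> W. h v = 2}"
  have sum_by: "(\<Sum>v\<in>W. f (h v)) = real n2 * f 2 + real n1 * f 1 + real n0 * f 0" for f :: "nat \<Rightarrow> real"
    using sum_over_h[OF le2] by (simp only: n0_def n1_def n2_def)
  have "real n2 * 2 + real n1 = 2 * k + 2 * q" "real n2 * 4 + real n1 = 4 * k + 2 * q" "real n2 + real n1 + real n0 = k + 2 * q + s"
    using sum_by[of real] sum_by[of "\<lambda>m. real m^2"] sum_by[of "\<lambda>_. 1"] m1 m2 W by simp_all
  then have "n2 = k" "n1 = 2 * q" "n0 = s" by linarith+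
  then show ?thesis
    by (intro cone_over_low_degree.intro cone_over_low_degree_axioms.intro)
      (use le2 cone_axioms in \<open>auto simp: n0_def n1_def n2_def\<close>)
qed

lemma cospectral_transfer:
  assumes "simple_graph G" "simple_graph H" and "q_cospectral G H"
  shows "card (pverts G) = card (pverts H)"
    and "(\<Sum>v\<in>pverts G. real (simple_graph.deg G v)) = (\<Sum>v\<in>pverts H. real (simple_graph.deg H v))"
    and "(\<Sum>v\<in>pverts G. real (simple_graph.deg G v)^2) = (\<Sum>v\<in>pverts H. real (simple_graph.deg H v)^2)"
    and "(\<Sum>v\<in>pverts G. real (simple_graph.deg G v)^3) + real (simple_graph.triangles G)
      = (\<Sum>v\<in>pverts H. real (simple_graph.deg H v)^3) + real (simple_graph.triangles H)"
    and "(\<exists>x. simple_graph.eigenfun G \<theta> x) \<longleftrightarrow> (\<exists>x. simple_graph.eigenfun H \<theta> x)"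
proof -
  interpret G: simple_graph G by fact
  interpret H: simple_graph H by fact
  have eq: "q_spectrum G = q_spectrum H" using assms(3) by (simp add: q_cospectral_def)
  note G = G.q_spectrum_power_sums[unfolded eq H.q_spectrum_power_sums]
  show "card (pverts G) = card (pverts H)" using G(1) by simp
  have 1: "(\<Sum>v\<in>pverts G. real (G.deg v)) = (\<Sum>v\<in>pverts H. real (H.deg v))"
    using G(2) unfolding of_real_eq_iff by simp
  then show "(\<Sum>v\<in>pverts G. real (G.deg v)) = (\<Sum>v\<in>pverts H. real (H.deg v))" .
  have "(\<Sum>v\<in>pverts G. real (G.deg v)^2 + real (G.deg v)) = (\<Sum>v\<in>pverts H. real (H.deg v)^2 + real (H.deg v))"
    using G(3) unfolding of_real_eq_iff G.trace2 H.trace2 by simp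
  then have 2: "(\<Sum>v\<in>pverts G. real (G.deg v)^2) = (\<Sum>v\<in>pverts H. real (H.deg v)^2)"
    using 1 by (simp add: sum.distrib)
  then show "(\<Sum>v\<in>pverts G. real (G.deg v)^2) = (\<Sum>v\<in>pverts H. real (H.deg v)^2)" .
  have "(\<Sum>v\<in>pverts G. real (G.deg v)^3 + 3 * real (G.deg v)^2) + real G.triangles
      = (\<Sum>v\<in>pverts H. real (H.deg v)^3 + 3 * real (H.deg v)^2) + real H.triangles"
    using G(4) unfolding of_real_eq_iff G.trace3 H.trace3 by simp
  then show "(\<Sum>v\<in>pverts G. real (G.deg v)^3) + real G.triangles
      = (\<Sum>v\<in>pverts H. real (H.deg v)^3) + real H.triangles"
    using 2 by (simp add: sum.distrib flip: sum_distrib_left)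
  show "(\<exists>x. G.eigenfun \<theta> x) \<longleftrightarrow> (\<exists>x. H.eigenfun \<theta> x)"
    using G.q_spectrum_real[of \<theta>] H.q_spectrum_real[of \<theta>] eq by simp
qed

text \<open>The argument proper. Each step provides the axioms of the next locale for \<open>F\<close>: the eigenvalue
  \<open>\<mu>\<close> and the traces make it a cone, the moments bound the base degrees, \<open>\<mu>\<close> again makes the paths
  single edges, and the absence of the eigenvalue 5 leaves one cycle.\<close>

theorem cospectral_cone_model:
  fixes F :: "'a pair_pre_digraph"
  assumes k: "k \<ge> 4" and N20: "k + 2 * q + s \<ge> 20"
    and F: "pair_graph F" and cosp: "q_cospectral F (cone_model k q s)"
  shows "F \<simeq> cone_model k q s"
proof -
  let ?M = "cone_model k q s"
  define N where "N = k + 2 * q + s"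
  interpret M: cone_over_cycle_and_edges ?M "Inl 0" k q s by (rule cone_model_instance[OF k])
  interpret F: simple_graph F by (rule simple_graph.intro[OF F])
  note tr = cospectral_transfer[OF F.simple_graph_axioms M.simple_graph_axioms cosp]
  have MW: "card M.W = N" by (simp add: M.card_W N_def)
  have cardM: "card (pverts ?M) = N + 1" using MW by (simp add: M.V_eq)
  have cardF: "card F.V = N + 1" using tr(1) cardM by simp
  note mom = M.degree_moments M.h_moments
  have s1: "(\<Sum>v\<in>F.V. real (F.deg v)) = 2 * (N + k + q)"
    using tr(2) mom(1,4) MW by simp
  have s2: "(\<Sum>v\<in>F.V. real (F.deg v)^2) = N\<^sup>2 + 9 * k + 8 * q + s"
    using tr(3) mom(2,4,5) MW by (simp add: N_def)
  have s3: "(\<Sum>v\<in>F.V. real (F.deg v)^3) + real F.triangles = N^3 + 33 * k + 22 * q + s"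
    using tr(4) mom(3,4,5,6) MW by (simp add: N_def)
  obtain \<mu> where \<mu>: "\<mu> > real N" "secular k q s \<mu> = 0"
    using secular_root_exists[of k q s] N20 by (auto simp: N_def)
  have \<mu>5: "\<mu> > 5" using \<mu>(1) N20 by (simp add: N_def)
  have only_F: "\<theta> = \<mu>" if "F.eigenfun \<theta> x" "\<theta> \<ge> 5" for \<theta> x
    using tr(5)[of \<theta>] that M.eigenvalue_ge_5[OF _ that(2) \<mu>5 \<mu>(2)] by blast
  obtain x where x: "F.eigenfun \<mu> x" using tr(5)[of \<mu>] M.secular_eigenfun[OF \<mu>5 \<mu>(2)] by blast
  have trace: "(\<Sum>u\<in>F.V. \<Sum>v\<in>F.V. F.Q u v * F.Q v u) < 2 * \<mu>\<^sup>2"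
  proof -
    have "(\<Sum>u\<in>F.V. \<Sum>v\<in>F.V. F.Q u v * F.Q v u) = real N ^ 2 + 9 * k + 8 * q + s + 2 * (N + k + q)"
      using s1 s2 by (simp add: F.trace2 sum.distrib)
    also have "\<dots> \<le> real N ^ 2 + 13 * real N" by (simp add: N_def)
    also have "\<dots> < 2 * real N ^ 2" using N20 by (simp add: N_def[symmetric] power2_eq_square)
    also have "\<dots> \<le> 2 * \<mu>\<^sup>2" using \<mu>(1) by (simp add: power_mono)
    finally show ?thesis .
  qed
  have deg5: "F.deg u \<le> 5 \<or> F.deg v \<le> 5" if "u \<in> F.V" "v \<in> F.V" "u \<noteq> v" for u v
  proof (rule ccontr)
    assume "\<not> ?thesis"
    then have "F.deg u \<ge> 6" "F.deg v \<ge> 6" by auto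
    from F.large_degree_unique[OF x only_F trace that this] show False .
  qed
  obtain z where z: "z \<in> F.V" "F.deg z = N"
    using F.dominating_vertex[OF cardF N_def _ s1 s2 s3 deg5] N20 by (auto simp: N_def)
  have "F.nbs z = F.V - {z}"
    by (rule card_seteq) (use z cardF F.adj_V in \<open>auto simp: F.deg_def\<close>)
  then have apex: "(z, v) \<in> parcs F" if "v \<in> F.V" "v \<noteq> z" for v
    using that F.mem_nbs by blast
  interpret F: cone F z
    by (intro cone.intro cone_axioms.intro F.simple_graph_axioms z apex)
  have FW: "card F.W = N" using z by (simp add: F.deg_z)
  have m1: "(\<Sum>v\<in>F.W. real (F.h v)) = 2 * k + 2 * q"
    using F.degree_moments(1) s1 FW by simp
  have m2: "(\<Sum>v\<in>F.W. real (F.h v)^2) = 4 * k + 2 * q"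
    using F.degree_moments(2) s2 m1 FW by (simp add: N_def)
  have m3: "(\<Sum>v\<in>F.W. real (F.h v)^3) + real F.base_triangles = 8 * k + 2 * q"
    using F.degree_moments(3) s3 m1 m2 FW by (simp add: N_def)
  interpret F: cone_over_low_degree F z k q s
    by (rule F.low_degree_of_moments[OF FW[unfolded N_def] m1 m2 m3])
  have same: "F.h w = F.h v" if "v \<in> F.W" "w \<in> F.nb v" for v w
    using F.same_degree_of_secular[OF x \<mu>5 \<mu>(2)] that by blast
  have no5: "\<not> (\<exists>x. F.eigenfun 5 x)" using tr(5)[of 5] M.not_eigenvalue_5 by blast
  have rim: "A = F.R" if "A \<subseteq> F.R" "A \<noteq> {}" "\<And>v. v \<in> A \<Longrightarrow> F.nb v \<subseteq> A" for A
    by (rule F.rim_connected) (fact same no5 that)+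
  interpret F: cone_over_cycle_and_edges F z k q s
    by (intro cone_over_cycle_and_edges.intro cone_over_cycle_and_edges_axioms.intro
      F.cone_over_low_degree_axioms k same rim)
  show ?thesis by (rule F.iso_cone_model)
qed

lemma graph_iso_sym:
  assumes "pair_graph G" "pair_graph H" "G \<simeq> H"
  shows "H \<simeq> G"
proof -
  obtain f where f: "bij_betw f (pverts G) (pverts H)"
    and e: "\<And>u v. u \<in> pverts G \<Longrightarrow> v \<in> pverts G \<Longrightarrow> (u,v) \<in> parcs G \<longleftrightarrow> (f u, f v) \<in> parcs H"
    using assms graph_iso_iff by blast
  let ?g = "inv_into (pverts G) f"
  have g: "bij_betw ?g (pverts H) (pverts G)" by (rule bij_betw_inv_into[OF f])
  have "(u,v) \<in> parcs H \<longleftrightarrow> (?g u, ?g v) \<in> parcs G" if "u \<in> pverts H" "v \<in> pverts H" for u v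
    using e[of "?g u" "?g v"] bij_betwE[OF g] that bij_betw_inv_into_right[OF f] by simp
  then show ?thesis unfolding graph_iso_iff[OF assms(2,1)] using g by blast
qed

lemma graph_iso_trans:
  assumes "pair_graph G" "pair_graph H" "pair_graph K" "G \<simeq> H" "H \<simeq> K"
  shows "G \<simeq> K"
proof -
  obtain f where f: "bij_betw f (pverts G) (pverts H)"
    and e: "\<And>u v. u \<in> pverts G \<Longrightarrow> v \<in> pverts G \<Longrightarrow> (u,v) \<in> parcs G \<longleftrightarrow> (f u, f v) \<in> parcs H"
    using assms graph_iso_iff[of G H] by blast
  obtain g where g: "bij_betw g (pverts H) (pverts K)"
    and e': "\<And>u v. u \<in> pverts H \<Longrightarrow> v \<in> pverts H \<Longrightarrow> (u,v) \<in> parcs H \<longleftrightarrow> (g u, g v) \<in> parcs K"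
    using assms graph_iso_iff[of H K] by blast
  have "bij_betw (g \<circ> f) (pverts G) (pverts K)" by (rule bij_betw_trans[OF f g])
  moreover have "(u,v) \<in> parcs G \<longleftrightarrow> ((g \<circ> f) u, (g \<circ> f) v) \<in> parcs K"
    if "u \<in> pverts G" "v \<in> pverts G" for u v
    using e[OF that] e'[of "f u" "f v"] bij_betwE[OF f] that by simp
  ultimately show ?thesis unfolding graph_iso_iff[OF assms(1,3)] by blast
qed

theorem determined_by_q_spectrum:
  fixes q s k :: nat and G :: "'a pair_pre_digraph" and F :: "'b pair_pre_digraph"
  assumes k: "k \<ge> 4" and G: "pair_graph G" and GM: "G \<simeq> cone_model k q s"
    and card: "card (pverts G) \<ge> 21" and F: "pair_graph F" and FG: "q_cospectral F G"
  shows "F \<simeq> G"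
proof -
  let ?M = "cone_model k q s"
  have M: "pair_graph ?M" by (rule pair_graph_cone_model[OF k])
  interpret M: cone_over_cycle_and_edges ?M "Inl 0" k q s by (rule cone_model_instance[OF k])
  have "card (pverts G) = card (pverts ?M)"
    using GM unfolding graph_iso_iff[OF G M] by (auto dest: bij_betw_same_card)
  also have "\<dots> = k + 2 * q + s + 1" by (simp add: M.V_eq M.card_W)
  finally have N: "k + 2 * q + s \<ge> 20" using card by simp
  have "q_cospectral F ?M"
    using FG graph_iso_imp_q_cospectral[OF G M GM] by (simp add: q_cospectral_def)
  then have "F \<simeq> ?M" by (rule cospectral_cone_model[OF k N F])
  then show ?thesis by (rule graph_iso_trans[OF F M G _ graph_iso_sym[OF G M GM]])
qed

theorem theorem1p1:
  fixes q s k :: nat and G :: "'a pair_pre_digraph" and F :: "'b pair_pre_digraph"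
  assumes "q \<ge> 1" "s \<ge> 1" "k \<ge> 4"
    and "pair_graph G"
    and "G \<simeq> complete_graph 1 \<or>\<^sub>g
      (cycle_graph k \<squnion>\<^sub>g q \<cdot>\<^sub>g complete_graph 2 \<squnion>\<^sub>g s \<cdot>\<^sub>g complete_graph 1)"
    and "card (pverts G) \<ge> 21"
  shows "(odd k \<longrightarrow> dqs G) \<and>
    (even k \<and> pair_graph F \<and> q_cospectral F G \<longrightarrow>
      F \<simeq> G \<or>
      (q \<ge> 2 \<and> F \<simeq> complete_graph 1 \<or>\<^sub>g
        (cycle_graph 4 \<squnion>\<^sub>g path_graph (k - 3) \<squnion>\<^sub>g path_graph 3
          \<squnion>\<^sub>g (q - 2) \<cdot>\<^sub>g complete_graph 2 \<squnion>\<^sub>g s \<cdot>\<^sub>g complete_graph 1)))"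
proof -
  have "G \<simeq> cone_model k q s" using assms(5) by (simp only: cone_model_def)
  note det = determined_by_q_spectrum[OF assms(3,4) this assms(6)]
  have "dqs G" unfolding dqs_def by (intro allI impI) (rule det)
  moreover have "F \<simeq> G" if "pair_graph F" "q_cospectral F G" using det[OF that] .
  ultimately show ?thesis by blast
qed

end
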